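(* Let $V$ be a finite-dimensional real vector space and $2\le p\le\dim V$. The following assignment is a one-to-one correspondence between linear Dirac structures $(P,\Omega)$ of order $p$ on $V$ relative to $\mathbb R$ and pairs $(S,\Pi)$ consisting of a subspace $S\subset V^*$ and a $p$-vector $\Pi\in\Lambda^pS^*$ satisfying condition (H'): to $(P,\Omega)$ associate $L^\perp=\{(Z,\eta)\in\Lambda^{p-1}V\times V^*: Z\in\Lambda^{p-1}P,\ i_Z\Omega=\eta|_P\}$, $S=\{\eta\in V^*:\exists Z,\ (Z,\eta)\in L^\perp\}$, and $\Pi\in\Lambda^pS^*$ (with $S^*$ identified with $V/\mathrm{Ann}(S)$) defined by $\Pi(\eta)=Z|_{\Lambda^{p-1}S}$ for $(Z,\eta)\in L^\perp$ (this is well defined and skew-symmetric).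
   Context: A linear Dirac structure of order $p$ on $V$ relative to $\mathbb R$ is a pair $(P,\Omega)$ where $P\subset V$ is a subspace and $\Omega\in\Lambda^pP^*$, satisfying condition (H): for all $Z_1,\dots,Z_{p-1}\in\Lambda^{p-1}P$ there exists $v\in P$ with $(i_{Z_1}\Omega)\wedge\dots\wedge(i_{Z_{p-1}}\Omega)=i_v\Omega$, where $(i_v\Omega)(Z)=\Omega(v\wedge Z)$ and $(i_Z\Omega)(w)=\Omega(Z\wedge w)$. For $\Pi\in\Lambda^pS^*$ and $\omega\in\Lambda^kS$, $\Pi(\omega)\in\Lambda^{p-k}S^*$ denotes the contraction $\langle\Pi(\omega),\xi\rangle=\Pi(\omega\wedge\xi)$. Condition (H'): for all $\omega_1,\dots,\omega_{p-1}\in\Lambda^{p-1}S$ there exists $\eta\in S$ with $\Pi(\omega_1)\wedge\dots\wedge\Pi(\omega_{p-1})=\Pi(\eta)$. *)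

theory Defs
  imports "HOL-Analysis.Analysis" "HOL-Combinatorics.Permutations"
begin

text \<open>
Conventions. A finite-dimensional real vector space V is a type 'v of class euclidean_space
(the inner product is never used); V^* is the set of linear maps 'v => real.
Since functions 'v => real carry no real_vector instance, the generic notions below take the
vector operations (addition ad, scalar multiplication sc) of the ambient space as parameters.

Alternating k-forms on a subspace U (i.e. elements of Lambda^k U^*) are represented by
functions f :: (nat => 'a) => real in canonical form: f only depends on the arguments
x 0, ..., x (k-1), vanishes unless all of them lie in U, and is multilinear and alternating
on U^k.  k-vectors on U (elements of Lambda^k U, which in finite dimension is the dual of
Lambda^k U^*) are represented as linear functionals on the space of alternating k-forms on U;
the pairing with decomposables is  <xi_1 ^ ... ^ xi_k, f> = f(xi_1,...,xi_k).
\<close>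

definition altform ::
  "('a \<Rightarrow> 'a \<Rightarrow> 'a) \<Rightarrow> (real \<Rightarrow> 'a \<Rightarrow> 'a) \<Rightarrow> 'a set \<Rightarrow> nat \<Rightarrow> ((nat \<Rightarrow> 'a) \<Rightarrow> real) \<Rightarrow> bool"
  where "altform ad sc U k f \<longleftrightarrow>
     (\<forall>x y. (\<forall>i<k. x i = y i) \<longrightarrow> f x = f y) \<and>
     (\<forall>x. \<not> (\<forall>i<k. x i \<in> U) \<longrightarrow> f x = 0) \<and>
     (\<forall>x i a b c. (\<forall>j<k. x j \<in> U) \<and> i < k \<and> a \<in> U \<and> b \<in> U \<longrightarrow>
         f (x(i := ad (sc c a) b)) = c * f (x(i := a)) + f (x(i := b))) \<and>
     (\<forall>x i j. (\<forall>l<k. x l \<in> U) \<and> i < k \<and> j < k \<and> i \<noteq> j \<and> x i = x j \<longrightarrow> f x = 0)"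

definition Forms ::
  "('a \<Rightarrow> 'a \<Rightarrow> 'a) \<Rightarrow> (real \<Rightarrow> 'a \<Rightarrow> 'a) \<Rightarrow> 'a set \<Rightarrow> nat \<Rightarrow> ((nat \<Rightarrow> 'a) \<Rightarrow> real) set"
  where "Forms ad sc U k = {f. altform ad sc U k f}"

text \<open>k-vectors on U: linear functionals on the space of alternating k-forms on U.\<close>
definition Kvecs ::
  "('a \<Rightarrow> 'a \<Rightarrow> 'a) \<Rightarrow> (real \<Rightarrow> 'a \<Rightarrow> 'a) \<Rightarrow> 'a set \<Rightarrow> nat \<Rightarrow> (((nat \<Rightarrow> 'a) \<Rightarrow> real) \<Rightarrow> real) set"
  where "Kvecs ad sc U k = {Z. \<forall>f\<in>Forms ad sc U k. \<forall>g\<in>Forms ad sc U k. \<forall>c.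
            Z (\<lambda>x. c * f x + g x) = c * Z f + Z g}"

text \<open>Contraction of a (k+1)-form Om with a k-vector Z: the covector w |-> Om(Z ^ w),
  represented as a 1-form (only the argument slot 0 matters).\<close>
definition contr_kvec ::
  "nat \<Rightarrow> ((nat \<Rightarrow> 'a) \<Rightarrow> real) \<Rightarrow> (((nat \<Rightarrow> 'a) \<Rightarrow> real) \<Rightarrow> real) \<Rightarrow> ((nat \<Rightarrow> 'a) \<Rightarrow> real)"
  where "contr_kvec k Om Z = (\<lambda>y. Z (\<lambda>x. Om (x(k := y 0))))"

text \<open>Contraction of a (k+1)-form with a vector v: the k-form Z |-> Om(v ^ Z).\<close>
definition contr_vec :: "((nat \<Rightarrow> 'a) \<Rightarrow> real) \<Rightarrow> 'a \<Rightarrow> ((nat \<Rightarrow> 'a) \<Rightarrow> real)"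
  where "contr_vec Om v = (\<lambda>x. Om (\<lambda>i. if i = 0 then v else x (i - 1)))"

text \<open>Wedge product of k covectors (given as 1-forms):
  (F_0 ^ ... ^ F_(k-1))(x_0,...,x_(k-1)) = det (F_i(x_j)).\<close>
definition wedge_cov :: "nat \<Rightarrow> (nat \<Rightarrow> ((nat \<Rightarrow> 'a) \<Rightarrow> real)) \<Rightarrow> ((nat \<Rightarrow> 'a) \<Rightarrow> real)"
  where "wedge_cov k F = (\<lambda>x. \<Sum>\<sigma>\<in>{\<sigma>. \<sigma> permutes {..<k}}.
            of_int (sign \<sigma>) * (\<Prod>i<k. F i (\<lambda>_. x (\<sigma> i))))"

text \<open>Operations of V and of V^*.\<close>
abbreviation vadd :: "'v::real_vector \<Rightarrow> 'v \<Rightarrow> 'v" where "vadd \<equiv> (+)"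
abbreviation vsc :: "real \<Rightarrow> 'v::real_vector \<Rightarrow> 'v" where "vsc \<equiv> (*\<^sub>R)"
definition cadd :: "('v \<Rightarrow> real) \<Rightarrow> ('v \<Rightarrow> real) \<Rightarrow> ('v \<Rightarrow> real)"
  where "cadd f g = (\<lambda>v. f v + g v)"
definition csc :: "real \<Rightarrow> ('v \<Rightarrow> real) \<Rightarrow> ('v \<Rightarrow> real)"
  where "csc c f = (\<lambda>v. c * f v)"

text \<open>Subspaces of V^*.\<close>
definition dual_subspace :: "('v::real_vector \<Rightarrow> real) set \<Rightarrow> bool"
  where "dual_subspace S \<longleftrightarrow> S \<subseteq> {f. linear f} \<and> (\<lambda>_. 0) \<in> S \<and>
      (\<forall>f\<in>S. \<forall>g\<in>S. \<forall>c. cadd (csc c f) g \<in> S)"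

text \<open>Linear Dirac structure of order p on V relative to R: condition (H).\<close>
definition linear_dirac :: "nat \<Rightarrow> 'v::real_vector set \<Rightarrow> ((nat \<Rightarrow> 'v) \<Rightarrow> real) \<Rightarrow> bool"
  where "linear_dirac p P Om \<longleftrightarrow> subspace P \<and> Om \<in> Forms vadd vsc P p \<and>
     (\<forall>Z. (\<forall>i<p-1. Z i \<in> Kvecs vadd vsc P (p-1)) \<longrightarrow>
        (\<exists>v\<in>P. wedge_cov (p-1) (\<lambda>i. contr_kvec (p-1) Om (Z i)) = contr_vec Om v))"

text \<open>Pairs (S, Pv) with S a subspace of V^*, Pv in Lambda^p S^*, satisfying (H').\<close>
definition condH' :: "nat \<Rightarrow> ('v::real_vector \<Rightarrow> real) set \<Rightarrow> ((nat \<Rightarrow> ('v \<Rightarrow> real)) \<Rightarrow> real) \<Rightarrow> bool"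
  where "condH' p S Pv \<longleftrightarrow> dual_subspace S \<and> Pv \<in> Forms cadd csc S p \<and>
     (\<forall>w. (\<forall>i<p-1. w i \<in> Kvecs cadd csc S (p-1)) \<longrightarrow>
        (\<exists>\<eta>\<in>S. wedge_cov (p-1) (\<lambda>i. contr_kvec (p-1) Pv (w i)) = contr_vec Pv \<eta>))"

text \<open>L^perp = {(Z, eta) : Z in Lambda^(p-1) P, eta in V^*, i_Z Om = eta restricted to P}.
  Here Z in Lambda^(p-1) P is represented intrinsically on P (Lambda^(p-1) P is a subspace of
  Lambda^(p-1) V via the injective canonical map).\<close>
definition Lperp :: "nat \<Rightarrow> 'v::real_vector set \<Rightarrow> ((nat \<Rightarrow> 'v) \<Rightarrow> real)
     \<Rightarrow> ((((nat \<Rightarrow> 'v) \<Rightarrow> real) \<Rightarrow> real) \<times> ('v \<Rightarrow> real)) set"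
  where "Lperp p P Om = {(Z, \<eta>). Z \<in> Kvecs vadd vsc P (p-1) \<and> linear \<eta> \<and>
            (\<forall>w\<in>P. contr_kvec (p-1) Om Z (\<lambda>_. w) = \<eta> w)}"

definition S_of :: "nat \<Rightarrow> 'v::real_vector set \<Rightarrow> ((nat \<Rightarrow> 'v) \<Rightarrow> real) \<Rightarrow> ('v \<Rightarrow> real) set"
  where "S_of p P Om = {\<eta>. \<exists>Z. (Z, \<eta>) \<in> Lperp p P Om}"

text \<open>Restriction of a (p-1)-vector Z on P to Lambda^(p-1) S, as a (p-1)-form on S:
  (xi_0,...,xi_(p-2)) |-> <Z, xi_0 ^ ... ^ xi_(p-2)>, where the wedge of the covectors
  xi_i is the (p-1)-form det(xi_i(u_j)) restricted to P.\<close>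
definition restrict_kvec :: "nat \<Rightarrow> 'v::real_vector set \<Rightarrow> ('v \<Rightarrow> real) set
     \<Rightarrow> (((nat \<Rightarrow> 'v) \<Rightarrow> real) \<Rightarrow> real) \<Rightarrow> ((nat \<Rightarrow> ('v \<Rightarrow> real)) \<Rightarrow> real)"
  where "restrict_kvec k P S Z = (\<lambda>\<xi>. if (\<forall>i<k. \<xi> i \<in> S)
      then Z (\<lambda>u. if (\<forall>j<k. u j \<in> P) then wedge_cov k (\<lambda>i y. \<xi> i (y 0)) u else 0)
      else 0)"

text \<open>Pv is the p-form on S determined by Pv(eta) = Z restricted to Lambda^(p-1) S
  for all (Z, eta) in L^perp.\<close>
definition is_Pi_of :: "nat \<Rightarrow> 'v::real_vector set \<Rightarrow> ((nat \<Rightarrow> 'v) \<Rightarrow> real)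
     \<Rightarrow> ((nat \<Rightarrow> ('v \<Rightarrow> real)) \<Rightarrow> real) \<Rightarrow> bool"
  where "is_Pi_of p P Om Pv \<longleftrightarrow> Pv \<in> Forms cadd csc (S_of p P Om) p \<and>
     (\<forall>(Z, \<eta>) \<in> Lperp p P Om. contr_vec Pv \<eta> = restrict_kvec (p-1) P (S_of p P Om) Z)"

definition dirac_to_pair :: "nat \<Rightarrow> 'v::real_vector set \<times> ((nat \<Rightarrow> 'v) \<Rightarrow> real)
     \<Rightarrow> ('v \<Rightarrow> real) set \<times> ((nat \<Rightarrow> ('v \<Rightarrow> real)) \<Rightarrow> real)"
  where "dirac_to_pair p = (\<lambda>(P, Om). (S_of p P Om, THE Pv. is_Pi_of p P Om Pv))"

end

theory Submission
  imports Defs "Jordan_Normal_Form.Determinant"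
begin

text \<open>
Identify V^* with V through the inner product; then L^perp consists of pairs (Z, a) with a a
vector, and these vectors a form a subspace S. For a_1, ..., a_(p-1) in S, condition (H) applied
to k-vectors Z_i with (Z_i, a_i) in L^perp says that the Gram form u |-> det(a_i . u_j) on P
equals i_v Omega for some v in P, and Cramer's rule shows that v is orthogonal to every a_i.
Hence Pi(a_0, ..., a_(p-1)) := +-(a_0 . v) is alternating, and it is the unique p-form on S
with i_a Pi = Z restricted to S for all (Z, a) in L^perp. Applied to (S, Pi), the same
construction returns (P, Omega): the nontrivial inclusion P \<subseteq> S(S, Pi) comes from expanding
i_b Omega in an orthonormal basis of S \<inter> P, which is legitimate because the vectors of P that
are orthogonal to S \<inter> P are null for Omega. So the construction is an involution of the linear
Dirac structures, and composing it with the identification V = V^* gives the bijection onto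
the pairs satisfying (H').
\<close>

no_notation scalar_prod (infix "\<bullet>" 70) and vec_nth (infixl "$" 90)

abbreviation args_in :: "'a set \<Rightarrow> nat \<Rightarrow> (nat \<Rightarrow> 'a) \<Rightarrow> bool" where
  "args_in U k x \<equiv> (\<forall>i<k. x i \<in> U)"

section \<open>Alternating forms and k-vectors\<close>

lemma Forms_cong: "f \<in> Forms ad sc U n \<Longrightarrow> (\<And>i. i < n \<Longrightarrow> x i = y i) \<Longrightarrow> f x = f y"
  unfolding Forms_def altform_def by blast

lemma Forms_vanish: "f \<in> Forms ad sc U n \<Longrightarrow> \<not> args_in U n x \<Longrightarrow> f x = 0"
  unfolding Forms_def altform_def by blast

lemma Forms_linear: "f \<in> Forms ad sc U n \<Longrightarrow> args_in U n x \<Longrightarrow> i < n \<Longrightarrow> a \<in> U \<Longrightarrow> b \<in> U \<Longrightarrow>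
   f (x(i := ad (sc c a) b)) = c * f (x(i := a)) + f (x(i := b))"
  unfolding Forms_def altform_def by blast

lemma Forms_alternating: "f \<in> Forms ad sc U n \<Longrightarrow> args_in U n x \<Longrightarrow> i < n \<Longrightarrow> j < n \<Longrightarrow> i \<noteq> j \<Longrightarrow>
   x i = x j \<Longrightarrow> f x = 0"
  unfolding Forms_def altform_def by blast

lemma Forms_zero: "(\<lambda>x. 0) \<in> Forms ad sc U n"
  unfolding Forms_def altform_def by auto

lemma Kvecs_linear: "Z \<in> Kvecs ad sc U n \<Longrightarrow> f \<in> Forms ad sc U n \<Longrightarrow> g \<in> Forms ad sc U n \<Longrightarrow>
   Z (\<lambda>x. c * f x + g x) = c * Z f + Z g"
  unfolding Kvecs_def by blast

lemma Kvecs_zero_form: "Z \<in> Kvecs ad sc U n \<Longrightarrow> Z (\<lambda>x. 0) = 0"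
  using Kvecs_linear[OF _ Forms_zero Forms_zero, of Z ad sc U n 2] by simp

context
  fixes U :: "'a::real_vector set" and k :: nat and f :: "(nat \<Rightarrow> 'a) \<Rightarrow> real"
  assumes f: "f \<in> Forms (+) (*\<^sub>R) U k" and U: "subspace U"
begin

lemma form_upd_zero: "args_in U k x \<Longrightarrow> i < k \<Longrightarrow> f (x(i := 0)) = 0"
  using Forms_linear[OF f, of x i 0 0 1] U by (simp add: subspace_0)

lemma form_upd_add: "args_in U k x \<Longrightarrow> i < k \<Longrightarrow> a \<in> U \<Longrightarrow> b \<in> U \<Longrightarrow>
   f (x(i := a + b)) = f (x(i := a)) + f (x(i := b))"
  using Forms_linear[OF f, of x i a b 1] by simp

lemma form_upd_sum: "finite J \<Longrightarrow> args_in U k x \<Longrightarrow> i < k \<Longrightarrow> (\<And>j. j \<in> J \<Longrightarrow> a j \<in> U) \<Longrightarrow>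
   f (x(i := (\<Sum>j\<in>J. c j *\<^sub>R a j))) = (\<Sum>j\<in>J. c j * f (x(i := a j)))"
proof (induction J rule: finite_induct)
  case empty
  then show ?case using form_upd_zero[of x i] by (simp only: sum.empty)
next
  case (insert j J)
  have s: "(\<Sum>j\<in>J. c j *\<^sub>R a j) \<in> U"
    using insert U by (intro subspace_sum) (auto intro: subspace_scale)
  have "f (x(i := (\<Sum>j\<in>insert j J. c j *\<^sub>R a j))) = f (x(i := c j *\<^sub>R a j + (\<Sum>j\<in>J. c j *\<^sub>R a j)))"
    by (simp only: sum.insert[OF insert(1,2)])
  also have "\<dots> = c j * f (x(i := a j)) + f (x(i := (\<Sum>j\<in>J. c j *\<^sub>R a j)))"
    using insert s by (intro Forms_linear[OF f]) auto
  finally show ?case using insert.IH insert.prems insert.hyps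
    by (simp only: sum.insert[OF insert(1,2)]) (auto simp: fun_upd_def)
qed

lemma form_comp_transpose:
  assumes x: "args_in U k x" and ab: "a < k" "b < k" "a \<noteq> b"
  shows "f (x \<circ> Transposition.transpose a b) = - f x"
proof -
  let ?s = "x a + x b"
  have xa: "x a \<in> U" and xb: "x b \<in> U" using x ab by auto
  have s: "?s \<in> U" using xa xb U by (simp add: subspace_add)
  have xbs: "args_in U k (x(b := ?s))" using x s by auto
  have 0: "f ((x(b := ?s))(a := ?s)) = 0"
    using ab xbs s by (intro Forms_alternating[OF f, of _ a b]) auto
  have e1: "f ((x(b := ?s))(a := ?s)) = f ((x(b := ?s))(a := x a)) + f ((x(b := ?s))(a := x b))"
    using form_upd_add[OF xbs ab(1) xa xb] .
  have xa': "args_in U k (x(a := x a))" "args_in U k (x(a := x b))" using x xa xb by auto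
  have "(x(b := ?s))(a := x a) = (x(a := x a))(b := ?s)" using ab by (auto simp: fun_eq_iff)
  then have e2: "f ((x(b := ?s))(a := x a)) = f ((x(a := x a))(b := x a)) + f ((x(a := x a))(b := x b))"
    using form_upd_add[OF xa'(1) ab(2) xa xb] by simp
  have eq3: "(x(b := ?s))(a := x b) = (x(a := x b))(b := ?s)" using ab by (auto simp: fun_eq_iff)
  have e3: "f ((x(b := ?s))(a := x b)) = f ((x(a := x b))(b := x a)) + f ((x(a := x b))(b := x b))"
    unfolding eq3 by (rule form_upd_add[OF xa'(2) ab(2) xa xb])
  have z1: "f ((x(a := x a))(b := x a)) = 0"
    using ab x xa by (intro Forms_alternating[OF f, of _ a b]) auto
  have z2: "f ((x(a := x b))(b := x b)) = 0"
    using ab x xb by (intro Forms_alternating[OF f, of _ a b]) auto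
  have i1: "(x(a := x a))(b := x b) = x" by auto
  have i2: "(x(a := x b))(b := x a) = x \<circ> Transposition.transpose a b"
    using ab by (auto simp: fun_eq_iff Transposition.transpose_def)
  show ?thesis using 0 e1 e2 e3 z1 z2 i1 i2 by simp
qed

lemma form_comp_permutes:
  assumes s: "\<sigma> permutes {..<k}" and x: "args_in U k x"
  shows "f (x \<circ> \<sigma>) = of_int (sign \<sigma>) * f x"
proof -
  have "\<forall>x. args_in U k x \<longrightarrow> f (x \<circ> \<sigma>) = of_int (sign \<sigma>) * f x"
    using s finite_lessThan
  proof (induction \<sigma> rule: permutes_induct)
    case id
    then show ?case by simp
  next
    case (swap a b p)
    show ?case
    proof (intro allI impI)
      fix x assume x: "args_in U k x"
      have xt: "args_in U k (x \<circ> Transposition.transpose a b)"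
        using swap x by (auto simp: Transposition.transpose_def)
      have "f (x \<circ> (Transposition.transpose a b \<circ> p)) = f ((x \<circ> Transposition.transpose a b) \<circ> p)"
        by (simp add: comp_assoc)
      also have "\<dots> = of_int (sign p) * f (x \<circ> Transposition.transpose a b)"
        using swap.IH xt by blast
      also have "\<dots> = - of_int (sign p) * f x" using form_comp_transpose[OF x] swap by simp
      also have "sign (Transposition.transpose a b \<circ> p) = - sign p"
        using swap by (simp add: sign_compose permutes_imp_permutation[OF finite_lessThan]
            sign_swap_id permutation_swap_id)
      ultimately show "f (x \<circ> (Transposition.transpose a b \<circ> p)) =
          of_int (sign (Transposition.transpose a b \<circ> p)) * f x" by simp
    qed
  qed
  then show ?thesis using x by blast
qed

end

lemma Forms_lincomb:
  assumes f: "f \<in> Forms (+) (*\<^sub>R) U k" and g: "g \<in> Forms (+) (*\<^sub>R) U k"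
  shows "(\<lambda>x. c * f x + g x) \<in> Forms (+) (*\<^sub>R) U k"
  unfolding Forms_def altform_def
proof (intro CollectI conjI allI impI)
  fix x y :: "nat \<Rightarrow> 'a" assume "\<forall>i<k. x i = y i"
  then show "c * f x + g x = c * f y + g y" using Forms_cong[OF f, of x y] Forms_cong[OF g, of x y] by simp
next
  fix x :: "nat \<Rightarrow> 'a" assume "\<not> args_in U k x"
  then show "c * f x + g x = 0" using Forms_vanish[OF f] Forms_vanish[OF g] by simp
next
  fix x :: "nat \<Rightarrow> 'a" and i a b d
  assume "args_in U k x \<and> i < k \<and> a \<in> U \<and> b \<in> U"
  then show "c * f (x(i := d *\<^sub>R a + b)) + g (x(i := d *\<^sub>R a + b)) =
     d * (c * f (x(i := a)) + g (x(i := a))) + (c * f (x(i := b)) + g (x(i := b)))"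
    using Forms_linear[OF f, of x i a b d] Forms_linear[OF g, of x i a b d] by (simp add: algebra_simps)
next
  fix x :: "nat \<Rightarrow> 'a" and i j
  assume "args_in U k x \<and> i < k \<and> j < k \<and> i \<noteq> j \<and> x i = x j"
  then show "c * f x + g x = 0"
    using Forms_alternating[OF f, of x i j] Forms_alternating[OF g, of x i j] by auto
qed

lemma Forms_scale: "f \<in> Forms (+) (*\<^sub>R) U k \<Longrightarrow> (\<lambda>x. c * f x) \<in> Forms (+) (*\<^sub>R) U k"
  using Forms_lincomb[OF _ Forms_zero, of f U k c] by simp

lemma Forms_sum:
  assumes "finite J" "\<And>j. j \<in> J \<Longrightarrow> f j \<in> Forms (+) (*\<^sub>R) U k"
  shows "(\<lambda>x. \<Sum>j\<in>J. c j * f j x) \<in> Forms (+) (*\<^sub>R) U k"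
  using assms
proof (induction J rule: finite_induct)
  case empty then show ?case using Forms_zero by simp
next
  case (insert j J)
  have "(\<lambda>x. c j * f j x + (\<Sum>j\<in>J. c j * f j x)) \<in> Forms (+) (*\<^sub>R) U k"
    using insert by (intro Forms_lincomb) auto
  then show ?case using insert by simp
qed

lemma Kvecs_scale: "Z \<in> Kvecs (+) (*\<^sub>R) U k \<Longrightarrow> f \<in> Forms (+) (*\<^sub>R) U k \<Longrightarrow>
   Z (\<lambda>x. c * f x) = c * Z f"
  using Kvecs_linear[OF _ _ Forms_zero, of Z _ _ U k f c] Kvecs_zero_form by simp

lemma Kvecs_sum:
  assumes Z: "Z \<in> Kvecs (+) (*\<^sub>R) U k" and "finite J" "\<And>j. j \<in> J \<Longrightarrow> f j \<in> Forms (+) (*\<^sub>R) U k"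
  shows "Z (\<lambda>x. \<Sum>j\<in>J. c j * f j x) = (\<Sum>j\<in>J. c j * Z (f j))"
  using assms(2,3)
proof (induction J rule: finite_induct)
  case empty then show ?case using Kvecs_zero_form[OF Z] by simp
next
  case (insert j J)
  have "Z (\<lambda>x. c j * f j x + (\<Sum>j\<in>J. c j * f j x)) = c j * Z (f j) + Z (\<lambda>x. \<Sum>j\<in>J. c j * f j x)"
    using insert by (intro Kvecs_linear[OF Z] Forms_sum) auto
  then show ?case using insert by simp
qed

lemma Kvecs_lincomb: "Z \<in> Kvecs (+) (*\<^sub>R) U k \<Longrightarrow> Z' \<in> Kvecs (+) (*\<^sub>R) U k \<Longrightarrow>
   (\<lambda>g. c * Z g + Z' g) \<in> Kvecs (+) (*\<^sub>R) U k"
  unfolding Kvecs_def by (auto simp: algebra_simps)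

lemma Kvecs_zero: "(\<lambda>g. 0) \<in> Kvecs ad sc U k"
  unfolding Kvecs_def by auto

lemma Kvecs_eval: "(\<lambda>g. g y) \<in> Kvecs ad sc U k"
  unfolding Kvecs_def by auto

lemma Kvecs_sum_eval: "finite J \<Longrightarrow> (\<lambda>g. \<Sum>j\<in>J. c j * g (y j)) \<in> Kvecs ad sc U k"
  unfolding Kvecs_def by (auto simp: algebra_simps sum.distrib sum_distrib_left)

section \<open>Gram determinants\<close>

lemma wedge_cov_eq_det: "wedge_cov k F x = det (mat k k (\<lambda>(i,j). F i (\<lambda>_. x j)))"
  unfolding wedge_cov_def det_def by (auto simp: atLeast0LessThan intro!: sum.cong prod.cong)

text \<open>(a_0 ^ ... ^ a_(k-1))(u_0, ..., u_(k-1)) for the covectors u |-> a_i . u.\<close>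

definition gram_det :: "nat \<Rightarrow> (nat \<Rightarrow> 'v::real_inner) \<Rightarrow> (nat \<Rightarrow> 'v) \<Rightarrow> real" where
  "gram_det k a u = wedge_cov k (\<lambda>i y. a i \<bullet> y 0) u"

lemma gram_det_eq_det: "gram_det k a u = det (mat k k (\<lambda>(i,j). a i \<bullet> u j))"
  unfolding gram_det_def wedge_cov_eq_det by simp

lemma gram_det_commute: "gram_det k a u = gram_det k u a"
proof -
  have "mat k k (\<lambda>(i,j). u i \<bullet> a j) = transpose_mat (mat k k (\<lambda>(i,j). a i \<bullet> u j))"
    by (auto simp: inner_commute)
  then show ?thesis unfolding gram_det_eq_det by (metis det_transpose mat_carrier)
qed

lemma gram_det_eq_rows: "i < k \<Longrightarrow> j < k \<Longrightarrow> i \<noteq> j \<Longrightarrow> a i = a j \<Longrightarrow> gram_det k a u = 0"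
  unfolding gram_det_eq_det by (rule det_identical_rows[of _ k i j]) (auto simp: Matrix.row_def)

lemma gram_det_eq_cols: "i < k \<Longrightarrow> j < k \<Longrightarrow> i \<noteq> j \<Longrightarrow> u i = u j \<Longrightarrow> gram_det k a u = 0"
  using gram_det_eq_rows[of i k j u a] gram_det_commute by metis

lemma gram_det_row_linear:
  assumes i: "i < k"
  shows "gram_det k (a(i := c *\<^sub>R b + b')) u = c * gram_det k (a(i := b)) u + gram_det k (a(i := b')) u"
proof -
  have "(\<Prod>l<k. (a(i := c *\<^sub>R b + b')) l \<bullet> u (\<sigma> l)) =
     c * (\<Prod>l<k. (a(i := b)) l \<bullet> u (\<sigma> l)) + (\<Prod>l<k. (a(i := b')) l \<bullet> u (\<sigma> l))" for \<sigma>
  proof -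
    let ?R = "\<Prod>l\<in>{..<k}-{i}. a l \<bullet> u (\<sigma> l)"
    have e: "(\<Prod>l<k. (a(i := z)) l \<bullet> u (\<sigma> l)) = (z \<bullet> u (\<sigma> i)) * ?R" for z
    proof -
      have "(\<Prod>l<k. (a(i := z)) l \<bullet> u (\<sigma> l))
          = (a(i := z)) i \<bullet> u (\<sigma> i) * (\<Prod>l\<in>{..<k}-{i}. (a(i := z)) l \<bullet> u (\<sigma> l))"
        using i by (subst prod.remove[of _ i]) auto
      also have "(\<Prod>l\<in>{..<k}-{i}. (a(i := z)) l \<bullet> u (\<sigma> l)) = ?R"
        by (intro prod.cong) (auto simp: fun_upd_def)
      finally show ?thesis by (simp add: fun_upd_def)
    qed
    show ?thesis unfolding e by (simp add: algebra_simps)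
  qed
  then show ?thesis unfolding gram_det_def wedge_cov_def
    by (simp add: sum.distrib sum_distrib_left algebra_simps)
qed

lemma gram_det_col_linear:
  assumes i: "i < k"
  shows "gram_det k a (u(i := c *\<^sub>R b + b')) = c * gram_det k a (u(i := b)) + gram_det k a (u(i := b'))"
  using gram_det_row_linear[OF i, of u c b b' a] gram_det_commute by metis

lemma gram_det_cong_cols: "(\<And>i. i < k \<Longrightarrow> u i = u' i) \<Longrightarrow> gram_det k a u = gram_det k a u'"
  unfolding gram_det_eq_det by (intro arg_cong[where f=det]) auto

lemma gram_det_cong_rows: "(\<And>i. i < k \<Longrightarrow> a i = a' i) \<Longrightarrow> gram_det k a u = gram_det k a' u"
  unfolding gram_det_eq_det by (intro arg_cong[where f=det]) auto

definition gram_form :: "nat \<Rightarrow> 'v::real_inner set \<Rightarrow> (nat \<Rightarrow> 'v) \<Rightarrow> (nat \<Rightarrow> 'v) \<Rightarrow> real" where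
  "gram_form k P a = (\<lambda>u. if args_in P k u then gram_det k a u else 0)"

lemma Forms_gram_form:
  assumes P: "subspace P"
  shows "gram_form k P a \<in> Forms (+) (*\<^sub>R) P k"
  unfolding Forms_def altform_def gram_form_def
proof (intro CollectI conjI allI impI)
  fix x y :: "nat \<Rightarrow> 'a" assume "\<forall>i<k. x i = y i"
  then show "(if args_in P k x then gram_det k a x else 0) = (if args_in P k y then gram_det k a y else 0)"
    using gram_det_cong_cols[of k x y a] by auto
next
  fix x :: "nat \<Rightarrow> 'a" assume "\<not> args_in P k x"
  then show "(if args_in P k x then gram_det k a x else 0) = 0" by auto
next
  fix x :: "nat \<Rightarrow> 'a" and i aa b c
  assume h: "args_in P k x \<and> i < k \<and> aa \<in> P \<and> b \<in> P"
  then have "c *\<^sub>R aa + b \<in> P" using P by (simp add: subspace_add subspace_scale)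
  then show "(if args_in P k (x(i := c *\<^sub>R aa + b)) then gram_det k a (x(i := c *\<^sub>R aa + b)) else 0) =
    c * (if args_in P k (x(i := aa)) then gram_det k a (x(i := aa)) else 0)
      + (if args_in P k (x(i := b)) then gram_det k a (x(i := b)) else 0)"
    using h gram_det_col_linear[of i k a x c aa b] by (auto simp: fun_upd_def)
next
  fix x :: "nat \<Rightarrow> 'a" and i j
  assume "args_in P k x \<and> i < k \<and> j < k \<and> i \<noteq> j \<and> x i = x j"
  then show "(if args_in P k x then gram_det k a x else 0) = 0" using gram_det_eq_cols[of i k j x a] by auto
qed

lemma wedge_cov_zero_column:
  assumes j: "j < k" and z: "\<And>i. i < k \<Longrightarrow> F i (\<lambda>_. x j) = 0"
  shows "wedge_cov k F x = 0"
  unfolding wedge_cov_def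
proof (intro sum.neutral ballI)
  fix \<sigma> assume "\<sigma> \<in> {\<sigma>. \<sigma> permutes {..<k}}"
  then have s: "\<sigma> permutes {..<k}" by simp
  have "Hilbert_Choice.inv \<sigma> j < k" using s j by (meson lessThan_iff permutes_in_image permutes_inv)
  moreover have "\<sigma> (Hilbert_Choice.inv \<sigma> j) = j" using s by (meson permutes_inverses(1))
  ultimately have "(\<Prod>i<k. F i (\<lambda>_. x (\<sigma> i))) = 0"
    using z by (intro prod_zero) (auto intro!: bexI[of _ "Hilbert_Choice.inv \<sigma> j"])
  then show "of_int (sign \<sigma>) * (\<Prod>i<k. F i (\<lambda>_. x (\<sigma> i))) = 0" by simp
qed

lemma gram_det_replace_col_zero_orthogonal:
  assumes nz: "gram_det k a u \<noteq> 0" and z: "\<And>l. l < k \<Longrightarrow> gram_det k a (u(l := v)) = 0" and i: "i < k"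
  shows "a i \<bullet> v = 0"
proof -
  define M where "M = mat k k (\<lambda>(i,j). a i \<bullet> u j)"
  define c where "c = vec k (\<lambda>i. a i \<bullet> v)"
  have M: "M \<in> carrier_mat k k" unfolding M_def by simp
  have c: "c \<in> carrier_vec k" unfolding c_def by simp
  have dM: "det M \<noteq> 0" using nz unfolding gram_det_eq_det M_def .
  from det_non_zero_imp_unit[OF M dM, of "()"]
  obtain B where BM: "M * B = 1\<^sub>m k" and B: "B \<in> carrier_mat k k"
    unfolding Units_def ring_mat_def by auto
  define x where "x = B *\<^sub>v c"
  have x: "x \<in> carrier_vec k" unfolding x_def using B c by simp
  have Mx: "M *\<^sub>v x = c" unfolding x_def
    using assoc_mult_mat_vec[OF M B c] BM c by simp
  have "x $ l = 0" if l: "l < k" for l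
  proof -
    have "replace_col M c l = mat k k (\<lambda>(i,j). a i \<bullet> (u(l := v)) j)"
      unfolding replace_col_def M_def c_def using l by (auto simp: fun_upd_def)
    then have "det (replace_col M c l) = 0" using z[OF l] unfolding gram_det_eq_det by simp
    then have "x $ l * det M = 0" using cramer_lemma_mat[OF M x l] Mx by simp
    then show ?thesis using dM by simp
  qed
  then have "x = 0\<^sub>v k" using x by (intro eq_vecI) auto
  then have "c = 0\<^sub>v k" using Mx M c by (intro eq_vecI) (auto simp: scalar_prod_def)
  then have "c $ i = 0" using i by simp
  then show ?thesis unfolding c_def using i by simp
qed

section \<open>Contractions\<close>

definition insert_at :: "nat \<Rightarrow> 'a \<Rightarrow> (nat \<Rightarrow> 'a) \<Rightarrow> nat \<Rightarrow> 'a" where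
  "insert_at j v x = (\<lambda>i. if i < j then x i else if i = j then v else x (i - 1))"

lemma contr_vec_insert_at: "contr_vec f v = (\<lambda>x. f (insert_at 0 v x))"
  unfolding contr_vec_def insert_at_def by simp

lemma args_in_insert_at: "v \<in> U \<Longrightarrow> args_in U k x \<Longrightarrow> args_in U (Suc k) (insert_at 0 v x)"
  unfolding insert_at_def by auto

lemma not_args_in_insert_at: "\<not> args_in U k x \<Longrightarrow> \<not> args_in U (Suc k) (insert_at 0 v x)"
proof -
  assume "\<not> args_in U k x"
  then obtain i where "i < k" "x i \<notin> U" by auto
  moreover have "insert_at 0 v x (Suc i) = x i" unfolding insert_at_def by simp
  ultimately show ?thesis by (metis Suc_less_eq)
qed

lemma not_args_in_upd: "\<not> args_in U k x \<Longrightarrow> \<not> args_in U (Suc k) (x(k := z))"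
proof -
  assume "\<not> args_in U k x"
  then obtain i where "i < k" "x i \<notin> U" by auto
  then show ?thesis by (metis fun_upd_other less_Suc_eq less_irrefl)
qed

lemma form_insert_front:
  assumes f: "f \<in> Forms (+) (*\<^sub>R) U (Suc k)" and U: "subspace U" and v: "v \<in> U" and x: "args_in U k x"
  shows "f (insert_at 0 v x) = (-1) ^ k * f (x(k := v))"
proof -
  have "j \<le> k \<Longrightarrow> f (insert_at j v x) = (-1) ^ j * f (insert_at 0 v x)" for j
  proof (induction j)
    case 0 then show ?case by simp
  next
    case (Suc j)
    have e: "insert_at (Suc j) v x = insert_at j v x \<circ> Transposition.transpose j (Suc j)"
      by (auto simp: fun_eq_iff insert_at_def Transposition.transpose_def)
    have i: "args_in U (Suc k) (insert_at j v x)" using x v Suc.prems by (auto simp: insert_at_def)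
    have "f (insert_at (Suc j) v x) = - f (insert_at j v x)"
      unfolding e using Suc.prems by (intro form_comp_transpose[OF f U i]) auto
    then show ?case using Suc by simp
  qed
  from this[of k] have "f (insert_at k v x) = (-1) ^ k * f (insert_at 0 v x)" by simp
  moreover have "f (insert_at k v x) = f (x(k := v))"
    by (intro Forms_cong[OF f]) (auto simp: insert_at_def fun_upd_def)
  ultimately show ?thesis by (metis left_minus_one_mult_self)
qed

lemma Forms_upd_last:
  assumes f: "f \<in> Forms (+) (*\<^sub>R) U (Suc k)" and U: "subspace U" and w: "w \<in> U"
  shows "(\<lambda>x. f (x(k := w))) \<in> Forms (+) (*\<^sub>R) U k"
  unfolding Forms_def altform_def
proof (intro CollectI conjI allI impI)
  fix x y :: "nat \<Rightarrow> 'a" assume "\<forall>i<k. x i = y i"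
  then show "f (x(k := w)) = f (y(k := w))" by (intro Forms_cong[OF f]) (auto simp: fun_upd_def)
next
  fix x :: "nat \<Rightarrow> 'a" assume "\<not> args_in U k x"
  then show "f (x(k := w)) = 0" by (intro Forms_vanish[OF f]) (auto simp: fun_upd_def)
next
  fix x :: "nat \<Rightarrow> 'a" and i a b c
  assume h: "args_in U k x \<and> i < k \<and> a \<in> U \<and> b \<in> U"
  have xk: "args_in U (Suc k) (x(k := w))" using h w by (auto simp: fun_upd_def)
  have "f ((x(k := w))(i := c *\<^sub>R a + b)) = c * f ((x(k := w))(i := a)) + f ((x(k := w))(i := b))"
    using h by (intro Forms_linear[OF f xk]) auto
  moreover have "(x(k := w))(i := z) = (x(i := z))(k := w)" for z using h by (auto simp: fun_eq_iff)
  ultimately show "f ((x(i := c *\<^sub>R a + b))(k := w)) = c * f ((x(i := a))(k := w)) + f ((x(i := b))(k := w))"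
    by metis
next
  fix x :: "nat \<Rightarrow> 'a" and i j
  assume h: "args_in U k x \<and> i < k \<and> j < k \<and> i \<noteq> j \<and> x i = x j"
  then show "f (x(k := w)) = 0" using w by (intro Forms_alternating[OF f, of _ i j]) (auto simp: fun_upd_def)
qed

lemma form_upd_last_outside:
  assumes f: "f \<in> Forms (+) (*\<^sub>R) U (Suc k)" and U: "subspace U" and w: "w \<notin> U"
  shows "(\<lambda>x. f (x(k := w))) = (\<lambda>x. 0)"
  using w by (intro ext Forms_vanish[OF f]) auto

lemma contr_kvec_outside:
  assumes f: "f \<in> Forms (+) (*\<^sub>R) U (Suc k)" and U: "subspace U" and w: "w \<notin> U"
    and Z: "Z \<in> Kvecs (+) (*\<^sub>R) U k"
  shows "contr_kvec k f Z (\<lambda>_. w) = 0"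
  unfolding contr_kvec_def using form_upd_last_outside[OF f U w] Kvecs_zero_form[OF Z] by simp

lemma contr_kvec_linear:
  assumes f: "f \<in> Forms (+) (*\<^sub>R) U (Suc k)" and U: "subspace U" and a: "a \<in> U" and b: "b \<in> U"
    and Z: "Z \<in> Kvecs (+) (*\<^sub>R) U k"
  shows "contr_kvec k f Z (\<lambda>_. c *\<^sub>R a + b) = c * contr_kvec k f Z (\<lambda>_. a) + contr_kvec k f Z (\<lambda>_. b)"
proof -
  have "(\<lambda>x. f (x(k := c *\<^sub>R a + b))) = (\<lambda>x. c * f (x(k := a)) + f (x(k := b)))"
  proof
    fix x :: "nat \<Rightarrow> 'a"
    show "f (x(k := c *\<^sub>R a + b)) = c * f (x(k := a)) + f (x(k := b))"
    proof (cases "args_in U k x")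
      case True
      then have xk: "args_in U (Suc k) (x(k := a))" using a by (auto simp: fun_upd_def)
      have "f ((x(k := a))(k := c *\<^sub>R a + b)) = c * f ((x(k := a))(k := a)) + f ((x(k := a))(k := b))"
        using a b by (intro Forms_linear[OF f xk]) auto
      then show ?thesis by (simp only: fun_upd_upd)
    next
      case False
      have "f (x(k := z)) = 0" for z using Forms_vanish[OF f not_args_in_upd[OF False]] .
      then show ?thesis by simp
    qed
  qed
  then show ?thesis unfolding contr_kvec_def
    using Kvecs_linear[OF Z Forms_upd_last[OF f U a] Forms_upd_last[OF f U b]] by simp
qed

lemma wedge_contr_kvec_eq_gram_form:
  assumes f: "f \<in> Forms (+) (*\<^sub>R) U (Suc k)" and U: "subspace U"
    and Z: "\<And>i. i < k \<Longrightarrow> Zs i \<in> Kvecs (+) (*\<^sub>R) U k"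
    and a: "\<And>i w. i < k \<Longrightarrow> w \<in> U \<Longrightarrow> contr_kvec k f (Zs i) (\<lambda>_. w) = a i \<bullet> w"
  shows "wedge_cov k (\<lambda>i. contr_kvec k f (Zs i)) = gram_form k U a"
proof
  fix u
  show "wedge_cov k (\<lambda>i. contr_kvec k f (Zs i)) u = gram_form k U a u"
  proof (cases "args_in U k u")
    case True
    show ?thesis unfolding gram_form_def gram_det_def wedge_cov_def using True
    proof (simp, intro sum.cong refl arg_cong[where f="\<lambda>x. _ * x"] prod.cong)
      fix \<sigma> i assume s: "\<sigma> \<in> {\<sigma>. \<sigma> permutes {..<k}}" and i: "i \<in> {..<k}"
      have "\<sigma> permutes {..<k}" "i < k" using s i by auto
      then have "\<sigma> i < k" by (meson lessThan_iff permutes_in_image)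
      then show "contr_kvec k f (Zs i) (\<lambda>_. u (\<sigma> i)) = a i \<bullet> u (\<sigma> i)"
        using a[OF \<open>i < k\<close>] True by blast
    qed
  next
    case False
    then obtain j where j: "j < k" "u j \<notin> U" by auto
    have "wedge_cov k (\<lambda>i. contr_kvec k f (Zs i)) u = 0"
      using j by (intro wedge_cov_zero_column[of j]) (auto intro!: contr_kvec_outside[OF f U] Z)
    then show ?thesis using False unfolding gram_form_def by auto
  qed
qed

lemma contr_vec_eq_upd_last:
  assumes f: "f \<in> Forms (+) (*\<^sub>R) U (Suc k)" and U: "subspace U" and v: "v \<in> U"
  shows "contr_vec f v = (\<lambda>x. (-1) ^ k * f (x(k := v)))"
proof
  fix x :: "nat \<Rightarrow> 'a"
  show "contr_vec f v x = (-1) ^ k * f (x(k := v))"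
  proof (cases "args_in U k x")
    case True
    then show ?thesis unfolding contr_vec_insert_at using form_insert_front[OF f U v] by simp
  next
    case False
    have "f (x(k := v)) = 0" using Forms_vanish[OF f not_args_in_upd[OF False]] .
    moreover have "f (insert_at 0 v x) = 0" using Forms_vanish[OF f not_args_in_insert_at[OF False]] .
    ultimately show ?thesis unfolding contr_vec_insert_at by simp
  qed
qed

lemma Forms_contr_vec:
  assumes f: "f \<in> Forms (+) (*\<^sub>R) U (Suc k)" and U: "subspace U" and v: "v \<in> U"
  shows "contr_vec f v \<in> Forms (+) (*\<^sub>R) U k"
  unfolding contr_vec_eq_upd_last[OF f U v] by (intro Forms_scale Forms_upd_last[OF f U v])

lemma form_null_vector_any_slot:
  assumes f: "f \<in> Forms (+) (*\<^sub>R) U (Suc k)" and U: "subspace U" and \<kappa>: "\<kappa> \<in> U"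
    and n: "\<And>z. args_in U k z \<Longrightarrow> f (z(k := \<kappa>)) = 0"
    and x: "args_in U (Suc k) x" and i: "i \<le> k"
  shows "f (x(i := \<kappa>)) = 0"
proof (cases "i = k")
  case True
  then show ?thesis using n[of x] x by auto
next
  case False
  then have ik: "i < k" using i by simp
  let ?y = "x(i := \<kappa>)"
  have y: "args_in U (Suc k) ?y" using x \<kappa> by (auto simp: fun_upd_def)
  have h: "f (?y \<circ> Transposition.transpose i k) = - f ?y"
    using ik by (intro form_comp_transpose[OF f U y]) auto
  have "f ?y = - f (?y \<circ> Transposition.transpose i k)" using h by linarith
  also have "?y \<circ> Transposition.transpose i k = (x(i := x k))(k := \<kappa>)"
    using ik by (auto simp: fun_eq_iff Transposition.transpose_def)
  also have "f \<dots> = 0" using n[of "x(i := x k)"] x by (auto simp: fun_upd_def)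
  finally show ?thesis by (simp add: fun_upd_def)
qed

section \<open>Orthogonal decompositions\<close>

lemma linear_on_sum:
  assumes U: "subspace U" and \<phi>: "\<And>a b c. a \<in> U \<Longrightarrow> b \<in> U \<Longrightarrow> \<phi> (c *\<^sub>R a + b) = c * \<phi> a + \<phi> b"
    and B: "finite B" "B \<subseteq> U"
  shows "\<phi> (\<Sum>e\<in>B. c e *\<^sub>R e) = (\<Sum>e\<in>B. c e * \<phi> e)"
  using B
proof (induction B rule: finite_induct)
  case empty
  have "\<phi> (1 *\<^sub>R 0 + 0) = 1 * \<phi> 0 + \<phi> 0" using \<phi>[of 0 0 1] U by (simp add: subspace_0)
  then show ?case by simp
next
  case (insert e B)
  have s: "(\<Sum>e\<in>B. c e *\<^sub>R e) \<in> U" using insert U by (intro subspace_sum subspace_scale) auto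
  show ?case using insert \<phi>[OF _ s, of e "c e"] by simp
qed

lemma riesz_subspace:
  fixes U :: "'v::euclidean_space set"
  assumes U: "subspace U" and \<phi>: "\<And>a b c. a \<in> U \<Longrightarrow> b \<in> U \<Longrightarrow> \<phi> (c *\<^sub>R a + b) = c * \<phi> a + \<phi> b"
  obtains y where "y \<in> U" "\<And>u. u \<in> U \<Longrightarrow> \<phi> u = y \<bullet> u"
proof -
  obtain B where B: "B \<subseteq> U" "pairwise real_inner_class.orthogonal B" "\<And>x. x \<in> B \<Longrightarrow> norm x = 1"
    "independent B" "span B = U"
    using orthonormal_basis_subspace[OF U] by metis
  have fB: "finite B" using B(4) independent_imp_finite by blast
  define y where "y = (\<Sum>e\<in>B. \<phi> e *\<^sub>R e)"
  have "y \<in> U" unfolding y_def using B(1) U by (intro subspace_sum subspace_scale) auto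
  moreover have "\<phi> u = y \<bullet> u" if u: "u \<in> U" for u
  proof -
    have "u = (\<Sum>e\<in>B. (u \<bullet> e) *\<^sub>R e)"
      using orthonormal_basis_expand[OF B(2,3) _ fB] u B(5) by simp
    then have "\<phi> u = (\<Sum>e\<in>B. (u \<bullet> e) * \<phi> e)"
      using linear_on_sum[OF U \<phi> fB B(1)] by metis
    also have "\<dots> = y \<bullet> u" unfolding y_def by (simp add: inner_sum_right inner_commute mult.commute)
    finally show ?thesis .
  qed
  ultimately show ?thesis using that by blast
qed

lemma orthogonal_projection_subspace:
  fixes U :: "'v::euclidean_space set"
  assumes U: "subspace U"
  obtains q where "q \<in> U" "\<And>w. w \<in> U \<Longrightarrow> (x - q) \<bullet> w = 0"
proof -
  obtain y z where "y \<in> span U" "\<And>w. w \<in> span U \<Longrightarrow> real_inner_class.orthogonal z w" "x = y + z"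
    using orthogonal_subspace_decomp_exists by metis
  moreover have "span U = U" using U by simp
  ultimately show ?thesis using that[of y] by (auto simp: real_inner_class.orthogonal_def)
qed

lemma in_subspace_if_orthogonal_perp:
  fixes P :: "'v::euclidean_space set"
  assumes P: "subspace P" and b: "\<And>\<zeta>. (\<And>w. w \<in> P \<Longrightarrow> \<zeta> \<bullet> w = 0) \<Longrightarrow> b \<bullet> \<zeta> = 0"
  shows "b \<in> P"
proof -
  obtain q where q: "q \<in> P" "\<And>w. w \<in> P \<Longrightarrow> (b - q) \<bullet> w = 0" using orthogonal_projection_subspace[OF P] by metis
  have "b \<bullet> (b - q) = 0" using b[of "b - q"] q by auto
  moreover have "q \<bullet> (b - q) = 0" using q(2)[OF q(1)] by (simp add: inner_commute)
  ultimately have "(b - q) \<bullet> (b - q) = 0" by (simp add: inner_diff_left)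
  then have "b = q" by simp
  then show ?thesis using q by simp
qed

lemma sum_PiE_lessThan_Suc:
  "(\<Sum>J\<in>PiE {..<Suc m} (\<lambda>_. B). F J) = (\<Sum>J\<in>PiE {..<m} (\<lambda>_. B). \<Sum>e\<in>B. F (J(m := e)))"
proof -
  have "(\<Sum>J\<in>PiE {..<m} (\<lambda>_. B). \<Sum>e\<in>B. F (J(m := e))) = (\<Sum>(e, J)\<in>B \<times> PiE {..<m} (\<lambda>_. B). F (J(m := e)))"
    by (subst sum.cartesian_product[symmetric]) (rule sum.swap)
  also have "\<dots> = (\<Sum>J\<in>PiE {..<Suc m} (\<lambda>_. B). F J)"
    by (rule sum.reindex_bij_witness[of _ "\<lambda>J'. (J' m, J'(m := undefined))" "\<lambda>(e, J). J(m := e)"])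
       (auto simp: PiE_def extensional_def Pi_def lessThan_Suc)
  finally show ?thesis by simp
qed

lemma form_upd_expand:
  assumes g: "g \<in> Forms (+) (*\<^sub>R) U k" and U: "subspace U" and B: "finite B" "B \<subseteq> U"
    and \<kappa>: "\<kappa> \<in> U" and null: "g (x(m := \<kappa>)) = 0" and x: "args_in U k x" and m: "m < k"
  shows "g (x(m := (\<Sum>e\<in>B. c e *\<^sub>R e) + \<kappa>)) = (\<Sum>e\<in>B. c e * g (x(m := e)))"
proof -
  have "(\<Sum>e\<in>B. c e *\<^sub>R e) \<in> U" using B U by (intro subspace_sum subspace_scale) auto
  then have "g (x(m := (\<Sum>e\<in>B. c e *\<^sub>R e) + \<kappa>)) = g (x(m := (\<Sum>e\<in>B. c e *\<^sub>R e))) + g (x(m := \<kappa>))"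
    by (rule form_upd_add[OF g U x m _ \<kappa>])
  also have "\<dots> = (\<Sum>e\<in>B. c e * g (x(m := e)))"
    using null B by (simp add: form_upd_sum[OF g U B(1) x m] subsetD)
  finally show ?thesis .
qed

lemma form_expand_coordinates:
  fixes U :: "'v::real_vector set"
  assumes g: "g \<in> Forms (+) (*\<^sub>R) U k" and U: "subspace U" and B: "finite B" "B \<subseteq> U"
    and w: "\<And>i. i < k \<Longrightarrow> w i = (\<Sum>e\<in>B. c i e *\<^sub>R e) + \<kappa> i"
    and \<kappa>: "\<And>i. i < k \<Longrightarrow> \<kappa> i \<in> U"
    and null: "\<And>x i. args_in U k x \<Longrightarrow> i < k \<Longrightarrow> g (x(i := \<kappa> i)) = 0"
  shows "g w = (\<Sum>J\<in>PiE {..<k} (\<lambda>_. B). (\<Prod>i<k. c i (J i)) * g J)"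
proof -
  define mrg where "mrg m J = (\<lambda>i. if i < m then J i else w i)" for m and J :: "nat \<Rightarrow> 'v"
  have wU: "w i \<in> U" if "i < k" for i
    using w[OF that] \<kappa>[OF that] B U by (simp add: subspace_add subspace_sum subspace_scale subsetD)
  have mU: "args_in U k (mrg m J)" if "J \<in> PiE {..<m} (\<lambda>_. B)" for m J
    using that wU B(2) unfolding mrg_def by (auto simp: PiE_def Pi_def)
  have main: "m \<le> k \<Longrightarrow> g w = (\<Sum>J\<in>PiE {..<m} (\<lambda>_. B). (\<Prod>i<m. c i (J i)) * g (mrg m J))" for m
  proof (induction m)
    case 0
    have "mrg 0 J = w" for J unfolding mrg_def by simp
    then show ?case by simp
  next
    case (Suc m)
    then have m: "m < k" by simp
    have step: "(\<Prod>i<m. c i (J i)) * g (mrg m J)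
        = (\<Sum>e\<in>B. (\<Prod>i<Suc m. c i ((J(m := e)) i)) * g (mrg (Suc m) (J(m := e))))"
      if J: "J \<in> PiE {..<m} (\<lambda>_. B)" for J
    proof -
      have "mrg m J = (mrg m J)(m := (\<Sum>e\<in>B. c m e *\<^sub>R e) + \<kappa> m)"
        using w[OF m] unfolding mrg_def by (auto simp: fun_eq_iff)
      then have "g (mrg m J) = g ((mrg m J)(m := (\<Sum>e\<in>B. c m e *\<^sub>R e) + \<kappa> m))"
        by (rule arg_cong)
      also have "\<dots> = (\<Sum>e\<in>B. c m e * g ((mrg m J)(m := e)))"
        by (rule form_upd_expand[OF g U B \<kappa>[OF m] null[OF mU[OF J] m] mU[OF J] m])
      finally have "g (mrg m J) = (\<Sum>e\<in>B. c m e * g ((mrg m J)(m := e)))" .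
      moreover have "(mrg m J)(m := e) = mrg (Suc m) (J(m := e))" for e
        unfolding mrg_def by (auto simp: fun_eq_iff)
      moreover have "(\<Prod>i<Suc m. c i ((J(m := e)) i)) = c m e * (\<Prod>i<m. c i (J i))" for e
        by (simp add: lessThan_Suc)
      ultimately show ?thesis by (simp add: sum_distrib_left algebra_simps)
    qed
    have "g w = (\<Sum>J\<in>PiE {..<m} (\<lambda>_. B). (\<Prod>i<m. c i (J i)) * g (mrg m J))"
      using Suc by simp
    also have "\<dots> = (\<Sum>J\<in>PiE {..<Suc m} (\<lambda>_. B). (\<Prod>i<Suc m. c i (J i)) * g (mrg (Suc m) J))"
      unfolding sum_PiE_lessThan_Suc by (rule sum.cong[OF refl step])
    finally show ?case .
  qed
  have "g (mrg k J) = g J" for J unfolding mrg_def by (intro Forms_cong[OF g]) auto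
  then show ?thesis using main[of k] by simp
qed

lemma form_expand_orthonormal:
  fixes U :: "'v::euclidean_space set"
  assumes g: "g \<in> Forms (+) (*\<^sub>R) U k" and U: "subspace U"
    and B: "finite B" "B \<subseteq> U" "pairwise real_inner_class.orthogonal B" "\<And>e. e \<in> B \<Longrightarrow> norm e = 1"
    and null: "\<And>\<kappa> x i. \<kappa> \<in> U \<Longrightarrow> (\<And>q. q \<in> span B \<Longrightarrow> \<kappa> \<bullet> q = 0) \<Longrightarrow> args_in U k x \<Longrightarrow> i < k \<Longrightarrow> g (x(i := \<kappa>)) = 0"
    and u: "args_in U k u"
  shows "g u = (\<Sum>J\<in>PiE {..<k} (\<lambda>_. B). (\<Prod>i<k. u i \<bullet> J i) * g J)"
proof (rule form_expand_coordinates[OF g U B(1,2)])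
  define \<kappa> where "\<kappa> i = u i - (\<Sum>e\<in>B. (u i \<bullet> e) *\<^sub>R e)" for i
  show "u i = (\<Sum>e\<in>B. (u i \<bullet> e) *\<^sub>R e) + \<kappa> i" for i unfolding \<kappa>_def by simp
  show \<kappa>U: "\<kappa> i \<in> U" if "i < k" for i
    unfolding \<kappa>_def using u that B(1,2) U by (intro subspace_diff subspace_sum subspace_scale) auto
  have \<kappa>perp: "\<kappa> i \<bullet> q = 0" if "q \<in> span B" for i q
  proof -
    have q: "q = (\<Sum>e\<in>B. (q \<bullet> e) *\<^sub>R e)"
      using orthonormal_basis_expand[OF B(3,4) that B(1)] by simp
    have "(\<Sum>e\<in>B. (u i \<bullet> e) *\<^sub>R e) \<bullet> q = u i \<bullet> q"
      by (subst (2) q) (simp add: inner_sum_left inner_sum_right inner_commute mult.commute)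
    then show ?thesis unfolding \<kappa>_def by (simp add: inner_diff_left)
  qed
  show "g (x(i := \<kappa> i)) = 0" if "args_in U k x" "i < k" for x i
    by (rule null, rule \<kappa>U[OF that(2)], rule \<kappa>perp, assumption, rule that(1), rule that(2))
qed

lemma form_gram_det_expansion:
  fixes U :: "'v::euclidean_space set"
  assumes g: "g \<in> Forms (+) (*\<^sub>R) U k" and U: "subspace U"
    and B: "finite B" "B \<subseteq> U" "pairwise real_inner_class.orthogonal B" "\<And>e. e \<in> B \<Longrightarrow> norm e = 1"
    and null: "\<And>\<kappa> x i. \<kappa> \<in> U \<Longrightarrow> (\<And>q. q \<in> span B \<Longrightarrow> \<kappa> \<bullet> q = 0) \<Longrightarrow> args_in U k x \<Longrightarrow> i < k \<Longrightarrow> g (x(i := \<kappa>)) = 0"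
    and u: "args_in U k u"
  shows "(\<Sum>J\<in>PiE {..<k} (\<lambda>_. B). g J * gram_det k J u) = fact k * g u"
proof -
  let ?P = "{\<sigma>. \<sigma> permutes {..<k}}"
  have "(\<Sum>J\<in>PiE {..<k} (\<lambda>_. B). g J * gram_det k J u) =
      (\<Sum>J\<in>PiE {..<k} (\<lambda>_. B). \<Sum>\<sigma>\<in>?P. of_int (sign \<sigma>) * ((\<Prod>i<k. u (\<sigma> i) \<bullet> J i) * g J))"
    unfolding gram_det_def wedge_cov_def
    by (intro sum.cong refl) (simp add: sum_distrib_left algebra_simps inner_commute)
  also have "\<dots> = (\<Sum>\<sigma>\<in>?P. of_int (sign \<sigma>) * (\<Sum>J\<in>PiE {..<k} (\<lambda>_. B). (\<Prod>i<k. u (\<sigma> i) \<bullet> J i) * g J))"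
    by (subst sum.swap) (simp add: sum_distrib_left)
  also have "\<dots> = (\<Sum>\<sigma>\<in>?P. of_int (sign \<sigma>) * g (u \<circ> \<sigma>))"
  proof (intro sum.cong refl arg_cong[where f="\<lambda>x. _ * x"])
    fix \<sigma> assume "\<sigma> \<in> ?P"
    then have s: "\<sigma> permutes {..<k}" by simp
    have "\<sigma> i < k" if "i < k" for i using s that by (meson lessThan_iff permutes_in_image)
    then have u\<sigma>: "args_in U k (u \<circ> \<sigma>)" using u by simp
    have "g (u \<circ> \<sigma>) = (\<Sum>J\<in>PiE {..<k} (\<lambda>_. B). (\<Prod>i<k. (u \<circ> \<sigma>) i \<bullet> J i) * g J)"
      by (rule form_expand_orthonormal[OF g U B(1-3) _ _ u\<sigma>], rule B(4), assumption, rule null, assumption+)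
    then show "(\<Sum>J\<in>PiE {..<k} (\<lambda>_. B). (\<Prod>i<k. u (\<sigma> i) \<bullet> J i) * g J) = g (u \<circ> \<sigma>)" by simp
  qed
  also have "\<dots> = (\<Sum>\<sigma>\<in>?P. g u)"
  proof (intro sum.cong refl)
    fix \<sigma> assume "\<sigma> \<in> ?P"
    then have "g (u \<circ> \<sigma>) = of_int (sign \<sigma>) * g u" using form_comp_permutes[OF g U _ u] by simp
    moreover have "(of_int (sign \<sigma>) :: real) * of_int (sign \<sigma>) = 1"
      by (metis of_int_1 of_int_mult sign_idempotent)
    ultimately show "of_int (sign \<sigma>) * g (u \<circ> \<sigma>) = g u" by (metis mult.assoc mult_1)
  qed
  also have "\<dots> = fact k * g u" using card_permutations[of "{..<k}" k] by simp
  finally show ?thesis .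
qed

lemma sum_gram_form_expansion:
  fixes U :: "'v::euclidean_space set"
  assumes g: "g \<in> Forms (+) (*\<^sub>R) U k" and U: "subspace U"
    and B: "finite B" "B \<subseteq> U" "pairwise real_inner_class.orthogonal B" "\<And>e. e \<in> B \<Longrightarrow> norm e = 1"
    and null: "\<And>\<kappa> x i. \<kappa> \<in> U \<Longrightarrow> (\<And>q. q \<in> span B \<Longrightarrow> \<kappa> \<bullet> q = 0) \<Longrightarrow> args_in U k x \<Longrightarrow> i < k \<Longrightarrow> g (x(i := \<kappa>)) = 0"
  shows "(\<lambda>u. \<Sum>J\<in>PiE {..<k} (\<lambda>_. B). g J * gram_form k U J u) = (\<lambda>u. fact k * g u)"
proof
  fix u
  show "(\<Sum>J\<in>PiE {..<k} (\<lambda>_. B). g J * gram_form k U J u) = fact k * g u"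
  proof (cases "args_in U k u")
    case True
    have "gram_form k U J u = gram_det k J u" for J unfolding gram_form_def by (rule if_P[OF True])
    moreover have "(\<Sum>J\<in>PiE {..<k} (\<lambda>_. B). g J * gram_det k J u) = fact k * g u"
      by (rule form_gram_det_expansion[OF g U B(1-3)], rule B(4), assumption, rule null, assumption+, rule True)
    ultimately show ?thesis by simp
  next
    case False
    have "gram_form k U J u = 0" for J unfolding gram_form_def by (rule if_not_P[OF False])
    then show ?thesis using Forms_vanish[OF g False] by simp
  qed
qed

section \<open>The dual of a linear Dirac structure\<close>

text \<open>L^perp, S, the restriction to S and the defining property of Pi, with each covector
  u |-> a . u replaced by the vector a.\<close>

definition Lperp_vec :: "nat \<Rightarrow> 'v::real_inner set \<Rightarrow> ((nat \<Rightarrow> 'v) \<Rightarrow> real)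
     \<Rightarrow> ((((nat \<Rightarrow> 'v) \<Rightarrow> real) \<Rightarrow> real) \<times> 'v) set" where
  "Lperp_vec k P Om = {(Z, a). Z \<in> Kvecs (+) (*\<^sub>R) P k \<and> (\<forall>w\<in>P. contr_kvec k Om Z (\<lambda>_. w) = a \<bullet> w)}"

definition S_vec :: "nat \<Rightarrow> 'v::real_inner set \<Rightarrow> ((nat \<Rightarrow> 'v) \<Rightarrow> real) \<Rightarrow> 'v set" where
  "S_vec k P Om = {a. \<exists>Z. (Z, a) \<in> Lperp_vec k P Om}"

definition restrict_vec :: "nat \<Rightarrow> 'v::real_inner set \<Rightarrow> 'v set
     \<Rightarrow> (((nat \<Rightarrow> 'v) \<Rightarrow> real) \<Rightarrow> real) \<Rightarrow> (nat \<Rightarrow> 'v) \<Rightarrow> real" where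
  "restrict_vec k P S Z = (\<lambda>\<xi>. if args_in S k \<xi> then Z (gram_form k P \<xi>) else 0)"

definition is_Pi_vec :: "nat \<Rightarrow> 'v::real_inner set \<Rightarrow> ((nat \<Rightarrow> 'v) \<Rightarrow> real) \<Rightarrow> ((nat \<Rightarrow> 'v) \<Rightarrow> real) \<Rightarrow> bool" where
  "is_Pi_vec k P Om Pv \<longleftrightarrow> Pv \<in> Forms (+) (*\<^sub>R) (S_vec k P Om) (Suc k) \<and>
     (\<forall>(Z, a) \<in> Lperp_vec k P Om. contr_vec Pv a = restrict_vec k P (S_vec k P Om) Z)"

lemma gram_form_cong_rows: "(\<And>i. i < k \<Longrightarrow> a i = a' i) \<Longrightarrow> gram_form k P a = gram_form k P a'"
  unfolding gram_form_def using gram_det_cong_rows by metis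

lemma Forms_eqI_contr_vec:
  assumes S: "subspace S" and f: "f \<in> Forms (+) (*\<^sub>R) S (Suc k)" and g: "g \<in> Forms (+) (*\<^sub>R) S (Suc k)"
    and e: "\<And>a. a \<in> S \<Longrightarrow> contr_vec f a = contr_vec g a"
  shows "f = g"
proof
  fix x :: "nat \<Rightarrow> 'a"
  show "f x = g x"
  proof (cases "x 0 \<in> S")
    case True
    have x: "x = insert_at 0 (x 0) (\<lambda>i. x (Suc i))" by (auto simp: fun_eq_iff insert_at_def)
    have "f x = contr_vec f (x 0) (\<lambda>i. x (Suc i))" unfolding contr_vec_insert_at using x by simp
    also have "\<dots> = contr_vec g (x 0) (\<lambda>i. x (Suc i))" using e[OF True] by simp
    also have "\<dots> = g x" unfolding contr_vec_insert_at using x by simp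
    finally show ?thesis .
  next
    case False
    then have "\<not> args_in S (Suc k) x" by auto
    then show ?thesis using Forms_vanish[OF f] Forms_vanish[OF g] by metis
  qed
qed

lemma restrict_vec_cong: "(\<And>i. i < k \<Longrightarrow> t i = t' i) \<Longrightarrow> restrict_vec k P S Z t = restrict_vec k P S Z t'"
  unfolding restrict_vec_def using gram_form_cong_rows[of k t t' P] by auto

lemma tail_upd_0: "(\<lambda>i. (x(0 := z)) (Suc i)) = (\<lambda>i. x (Suc i))"
  by auto

lemma tail_upd_Suc: "(\<lambda>i. (x(Suc j := z)) (Suc i)) = (\<lambda>i. x (Suc i))(j := z)"
  by (auto simp: fun_eq_iff)

lemma gram_form_row_linear: "i < k \<Longrightarrow>
  gram_form k P (t(i := c *\<^sub>R a + b)) = (\<lambda>u. c * gram_form k P (t(i := a)) u + gram_form k P (t(i := b)) u)"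
  unfolding gram_form_def using gram_det_row_linear by (auto simp: fun_eq_iff)

lemma restrict_vec_eval:
  assumes "args_in P k y"
  shows "restrict_vec k P S (\<lambda>g. g y) = gram_form k S y"
proof
  fix \<xi>
  show "restrict_vec k P S (\<lambda>g. g y) \<xi> = gram_form k S y \<xi>"
    using assms gram_det_commute[of k \<xi> y] unfolding restrict_vec_def gram_form_def by auto
qed

locale dirac =
  fixes k :: nat and P :: "'v::euclidean_space set" and Om :: "(nat \<Rightarrow> 'v) \<Rightarrow> real"
  assumes LD: "linear_dirac (Suc k) P Om"
begin

lemma P_subspace: "subspace P" using LD unfolding linear_dirac_def by simp
lemma Om_Forms: "Om \<in> Forms (+) (*\<^sub>R) P (Suc k)" using LD unfolding linear_dirac_def by simp
lemma condH: "(\<And>i. i < k \<Longrightarrow> Zs i \<in> Kvecs (+) (*\<^sub>R) P k) \<Longrightarrow>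
   \<exists>v\<in>P. wedge_cov k (\<lambda>i. contr_kvec k Om (Zs i)) = contr_vec Om v"
  using LD unfolding linear_dirac_def by simp

abbreviation "S \<equiv> S_vec k P Om"
abbreviation "L \<equiv> Lperp_vec k P Om"

lemma Lperp_vecD: "(Z, a) \<in> L \<Longrightarrow> Z \<in> Kvecs (+) (*\<^sub>R) P k"
    "(Z, a) \<in> L \<Longrightarrow> w \<in> P \<Longrightarrow> contr_kvec k Om Z (\<lambda>_. w) = a \<bullet> w"
  unfolding Lperp_vec_def by auto

lemma Lperp_vec_exists:
  assumes Z: "Z \<in> Kvecs (+) (*\<^sub>R) P k"
  obtains a where "a \<in> P" "(Z, a) \<in> L"
proof -
  obtain y where "y \<in> P" "\<And>u. u \<in> P \<Longrightarrow> contr_kvec k Om Z (\<lambda>_. u) = y \<bullet> u"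
    using riesz_subspace[OF P_subspace, of "\<lambda>w. contr_kvec k Om Z (\<lambda>_. w)"]
      contr_kvec_linear[OF Om_Forms P_subspace _ _ Z] by metis
  then show ?thesis using that[of y] Z unfolding Lperp_vec_def by auto
qed

lemma S_subspace: "subspace S"
  unfolding subspace_def
proof (intro conjI ballI allI)
  show "0 \<in> S" unfolding S_vec_def Lperp_vec_def
    using Kvecs_zero by (auto intro!: exI[of _ "\<lambda>g. 0"] simp: contr_kvec_def)
next
  fix x y assume "x \<in> S" "y \<in> S"
  then obtain Zx Zy where "(Zx, x) \<in> L" "(Zy, y) \<in> L" unfolding S_vec_def by auto
  then show "x + y \<in> S" unfolding S_vec_def Lperp_vec_def
    by (auto intro!: exI[of _ "\<lambda>g. 1 * Zx g + Zy g"] Kvecs_lincomb simp: contr_kvec_def inner_add_left)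
next
  fix c x assume "x \<in> S"
  then obtain Zx where "(Zx, x) \<in> L" unfolding S_vec_def by auto
  then show "c *\<^sub>R x \<in> S" unfolding S_vec_def Lperp_vec_def
    by (auto intro!: exI[of _ "\<lambda>g. c * Zx g + 0"] Kvecs_lincomb Kvecs_zero simp: contr_kvec_def)
qed

lemma Lperp_vec_zero: "(\<And>w. w \<in> P \<Longrightarrow> a \<bullet> w = 0) \<Longrightarrow> ((\<lambda>g. 0), a) \<in> L"
  unfolding Lperp_vec_def using Kvecs_zero by (auto simp: contr_kvec_def)

lemma perp_in_S: "(\<And>w. w \<in> P \<Longrightarrow> a \<bullet> w = 0) \<Longrightarrow> a \<in> S"
  using Lperp_vec_zero unfolding S_vec_def by blast

definition kvec_of :: "'v \<Rightarrow> ((nat \<Rightarrow> 'v) \<Rightarrow> real) \<Rightarrow> real" where "kvec_of a = (SOME Z. (Z, a) \<in> L)"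

lemma kvec_of_Lperp: "a \<in> S \<Longrightarrow> (kvec_of a, a) \<in> L"
proof -
  assume "a \<in> S"
  then obtain Z where "(Z, a) \<in> L" unfolding S_vec_def by auto
  then show ?thesis unfolding kvec_of_def using someI[of "\<lambda>Z. (Z, a) \<in> L" Z] by blast
qed

lemma wedge_contr_Lperp:
  assumes "\<And>i. i < k \<Longrightarrow> (Zs i, \<xi> i) \<in> L"
  shows "wedge_cov k (\<lambda>i. contr_kvec k Om (Zs i)) = gram_form k P \<xi>"
  using assms by (intro wedge_contr_kvec_eq_gram_form[OF Om_Forms P_subspace] Lperp_vecD)

lemma condH_S:
  assumes \<xi>: "args_in S k \<xi>"
  obtains v where "v \<in> P" "gram_form k P \<xi> = contr_vec Om v"
proof -
  have "\<exists>v\<in>P. wedge_cov k (\<lambda>i. contr_kvec k Om (kvec_of (\<xi> i))) = contr_vec Om v"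
    using \<xi> by (intro condH Lperp_vecD(1)[OF kvec_of_Lperp]) auto
  then show ?thesis using wedge_contr_Lperp[of "\<lambda>i. kvec_of (\<xi> i)" \<xi>] kvec_of_Lperp \<xi> that by auto
qed

lemma Lperp_vec_contr_vec:
  assumes Za: "(Z, a) \<in> L" and v: "v \<in> P"
  shows "Z (contr_vec Om v) = (-1) ^ k * (a \<bullet> v)"
proof -
  have "Z (contr_vec Om v) = Z (\<lambda>x. (-1) ^ k * Om (x(k := v)))"
    unfolding contr_vec_eq_upd_last[OF Om_Forms P_subspace v] ..
  also have "\<dots> = (-1) ^ k * Z (\<lambda>x. Om (x(k := v)))"
    by (rule Kvecs_scale[OF Lperp_vecD(1)[OF Za] Forms_upd_last[OF Om_Forms P_subspace v]])
  also have "Z (\<lambda>x. Om (x(k := v))) = a \<bullet> v" using Lperp_vecD(2)[OF Za v] unfolding contr_kvec_def .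
  finally show ?thesis .
qed

lemma restrict_vec_eq:
  assumes Za: "(Z, a) \<in> L" and \<xi>: "args_in S k \<xi>" and v: "v \<in> P" and D: "gram_form k P \<xi> = contr_vec Om v"
  shows "restrict_vec k P S Z \<xi> = (-1) ^ k * (a \<bullet> v)"
  unfolding restrict_vec_def using \<xi> D Lperp_vec_contr_vec[OF Za v] by simp

lemma condH_orthogonal:
  assumes \<xi>: "args_in S k \<xi>" and v: "v \<in> P" and D: "gram_form k P \<xi> = contr_vec Om v" and i: "i < k"
  shows "\<xi> i \<bullet> v = 0"
proof (cases "\<forall>u. args_in P k u \<longrightarrow> gram_det k \<xi> u = 0")
  case True
  then have "gram_form k P \<xi> = (\<lambda>_. 0)" unfolding gram_form_def by auto
  then have "contr_vec Om v = (\<lambda>_. 0)" using D by simp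
  then have "(-1) ^ k * (\<xi> i \<bullet> v) = kvec_of (\<xi> i) (\<lambda>_. 0)"
    using Lperp_vec_contr_vec[OF kvec_of_Lperp v, of "\<xi> i"] \<xi> i by simp
  also have "\<dots> = 0" using Kvecs_zero_form[OF Lperp_vecD(1)[OF kvec_of_Lperp]] \<xi> i by auto
  finally show ?thesis by simp
next
  case False
  then obtain u where u: "args_in P k u" "gram_det k \<xi> u \<noteq> 0" by auto
  have "gram_det k \<xi> (u(l := v)) = 0" if l: "l < k" for l
  proof -
    have ul: "args_in P k (u(l := v))" using u v by (auto simp: fun_upd_def)
    have "gram_det k \<xi> (u(l := v)) = gram_form k P \<xi> (u(l := v))" unfolding gram_form_def using ul by simp
    also have "\<dots> = Om (insert_at 0 v (u(l := v)))" unfolding D contr_vec_insert_at ..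
    also have "\<dots> = 0"
      using l ul v by (intro Forms_alternating[OF Om_Forms, of _ 0 "Suc l"]) (auto simp: insert_at_def)
    finally show ?thesis .
  qed
  then show ?thesis using gram_det_replace_col_zero_orthogonal[OF u(2) _ i] by blast
qed

text \<open>Pi(a_0, a_1, ..., a_k) := Z(a_1 ^ ... ^ a_k) for any Z with (Z, a_0) in L^perp; by
  Pi_vec_eq the value does not depend on the choice of Z.\<close>

definition Pi_vec :: "(nat \<Rightarrow> 'v) \<Rightarrow> real" where
  "Pi_vec = (\<lambda>x. if args_in S (Suc k) x then restrict_vec k P S (kvec_of (x 0)) (\<lambda>i. x (Suc i)) else 0)"

lemma Pi_vec_eq:
  assumes x: "args_in S (Suc k) x" and v: "v \<in> P" and D: "gram_form k P (\<lambda>i. x (Suc i)) = contr_vec Om v"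
  shows "Pi_vec x = (-1) ^ k * (x 0 \<bullet> v)"
proof -
  have "x 0 \<in> S" "args_in S k (\<lambda>i. x (Suc i))" using x by auto
  then show ?thesis unfolding Pi_vec_def using x restrict_vec_eq[OF kvec_of_Lperp[of "x 0"] _ v D] by simp
qed

lemma Pi_vec_linear:
  assumes x: "args_in S (Suc k) x" and i: "i < Suc k" and a: "a \<in> S" and b: "b \<in> S"
  shows "Pi_vec (x(i := c *\<^sub>R a + b)) = c * Pi_vec (x(i := a)) + Pi_vec (x(i := b))"
proof -
  have cab: "c *\<^sub>R a + b \<in> S" using a b S_subspace by (simp add: subspace_add subspace_scale)
  have xz: "args_in S (Suc k) (x(i := z))" if "z \<in> S" for z using x that by (auto simp: fun_upd_def)
  show ?thesis
  proof (cases i)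
    case 0
    have t: "args_in S k (\<lambda>i. x (Suc i))" using x by auto
    obtain v where v: "v \<in> P" "gram_form k P (\<lambda>i. x (Suc i)) = contr_vec Om v" using condH_S[OF t] by metis
    have f: "Pi_vec (x(0 := z)) = (-1) ^ k * (z \<bullet> v)" if "z \<in> S" for z
      using Pi_vec_eq[OF xz[OF that, unfolded 0] v(1)] v(2) tail_upd_0[of x z] by (simp add: fun_upd_def)
    show ?thesis unfolding 0 using f[OF cab] f[OF a] f[OF b] by (simp add: algebra_simps)
  next
    case (Suc j)
    then have j: "j < k" using i by simp
    let ?t = "\<lambda>i. x (Suc i)"
    have t: "args_in S k ?t" using x by auto
    have x0: "x 0 \<in> S" using x by auto
    have f: "Pi_vec (x(Suc j := z)) = kvec_of (x 0) (gram_form k P (?t(j := z)))" if "z \<in> S" for z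
    proof -
      have "args_in S k (?t(j := z))" using t that by (auto simp: fun_upd_def)
      then show ?thesis unfolding Pi_vec_def restrict_vec_def
        using xz[OF that] Suc tail_upd_Suc[of x j z] by simp
    qed
    have Z: "kvec_of (x 0) \<in> Kvecs (+) (*\<^sub>R) P k" using Lperp_vecD(1)[OF kvec_of_Lperp[OF x0]] .
    show ?thesis unfolding Suc f[OF cab] f[OF a] f[OF b] gram_form_row_linear[OF j]
      by (rule Kvecs_linear[OF Z Forms_gram_form[OF P_subspace] Forms_gram_form[OF P_subspace]])
  qed
qed

lemma Pi_vec_alternating:
  assumes x: "args_in S (Suc k) x" and h: "i < Suc k" "j < Suc k" "i \<noteq> j" "x i = x j"
  shows "Pi_vec x = 0"
proof -
  let ?t = "\<lambda>i. x (Suc i)"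
  have t: "args_in S k ?t" using x by auto
  show ?thesis
  proof (cases "i = 0 \<or> j = 0")
    case True
    then obtain m where m: "m < k" "x (Suc m) = x 0" using h
      by (metis less_Suc_eq_0_disj)
    obtain v where v: "v \<in> P" "gram_form k P ?t = contr_vec Om v" using condH_S[OF t] by metis
    have "Pi_vec x = (-1) ^ k * (x 0 \<bullet> v)" using Pi_vec_eq[OF x v] .
    also have "x 0 \<bullet> v = 0" using condH_orthogonal[OF t v(1) v(2) m(1)] m(2) by simp
    finally show ?thesis by simp
  next
    case False
    then obtain i' j' where ij: "i = Suc i'" "j = Suc j'" by (metis not0_implies_Suc)
    then have "gram_form k P ?t = (\<lambda>_. 0)" unfolding gram_form_def using h
      by (auto simp: fun_eq_iff intro!: gram_det_eq_rows[of i' k j'])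
    moreover have x0: "x 0 \<in> S" using x by auto
    ultimately show ?thesis unfolding Pi_vec_def restrict_vec_def
      using Kvecs_zero_form[OF Lperp_vecD(1)[OF kvec_of_Lperp[OF x0]]] t x by simp
  qed
qed

lemma Forms_Pi_vec: "Pi_vec \<in> Forms (+) (*\<^sub>R) S (Suc k)"
  unfolding Forms_def altform_def
proof (intro CollectI conjI allI impI)
  fix x y :: "nat \<Rightarrow> 'v" assume h: "\<forall>i<Suc k. x i = y i"
  then have "args_in S (Suc k) x = args_in S (Suc k) y" by auto
  moreover have "x 0 = y 0" using h by auto
  moreover have "restrict_vec k P S Z (\<lambda>i. x (Suc i)) = restrict_vec k P S Z (\<lambda>i. y (Suc i))" for Z
    using h by (intro restrict_vec_cong) auto
  ultimately show "Pi_vec x = Pi_vec y" unfolding Pi_vec_def by (simp only:)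
next
  fix x :: "nat \<Rightarrow> 'v" assume "\<not> args_in S (Suc k) x"
  then show "Pi_vec x = 0" unfolding Pi_vec_def by (rule if_not_P)
next
  fix x :: "nat \<Rightarrow> 'v" and i a b c
  assume "args_in S (Suc k) x \<and> i < Suc k \<and> a \<in> S \<and> b \<in> S"
  then show "Pi_vec (x(i := c *\<^sub>R a + b)) = c * Pi_vec (x(i := a)) + Pi_vec (x(i := b))"
    by (intro Pi_vec_linear) auto
next
  fix x :: "nat \<Rightarrow> 'v" and i j
  assume "args_in S (Suc k) x \<and> i < Suc k \<and> j < Suc k \<and> i \<noteq> j \<and> x i = x j"
  then show "Pi_vec x = 0" by (intro Pi_vec_alternating[of x i j]) auto
qed

lemma contr_vec_Pi_vec:
  assumes Za: "(Z, a) \<in> L"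
  shows "contr_vec Pi_vec a = restrict_vec k P S Z"
proof
  fix \<xi>
  have a: "a \<in> S" using Za unfolding S_vec_def by auto
  show "contr_vec Pi_vec a \<xi> = restrict_vec k P S Z \<xi>"
  proof (cases "args_in S k \<xi>")
    case True
    obtain v where v: "v \<in> P" "gram_form k P \<xi> = contr_vec Om v" using condH_S[OF True] by metis
    have x: "args_in S (Suc k) (insert_at 0 a \<xi>)" using args_in_insert_at[OF a True] .
    have t: "(\<lambda>i. insert_at 0 a \<xi> (Suc i)) = \<xi>" by (auto simp: insert_at_def)
    have "contr_vec Pi_vec a \<xi> = (-1) ^ k * (a \<bullet> v)"
      unfolding contr_vec_insert_at using Pi_vec_eq[OF x v(1)] v(2) t by (simp add: insert_at_def)
    also have "\<dots> = restrict_vec k P S Z \<xi>" using restrict_vec_eq[OF Za True v] by simp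
    finally show ?thesis .
  next
    case False
    have n1: "\<not> args_in S (Suc k) (insert_at 0 a \<xi>)" by (rule not_args_in_insert_at[OF False])
    have "contr_vec Pi_vec a \<xi> = 0" unfolding contr_vec_insert_at Pi_vec_def by (rule if_not_P[OF n1])
    moreover have "restrict_vec k P S Z \<xi> = 0" unfolding restrict_vec_def by (rule if_not_P[OF False])
    ultimately show ?thesis by simp
  qed
qed

lemma is_Pi_vec_iff: "is_Pi_vec k P Om Pv \<longleftrightarrow> Pv = Pi_vec"
proof
  assume h: "is_Pi_vec k P Om Pv"
  show "Pv = Pi_vec"
  proof (rule Forms_eqI_contr_vec[OF S_subspace])
    show "Pv \<in> Forms (+) (*\<^sub>R) S (Suc k)" using h unfolding is_Pi_vec_def by simp
    show "Pi_vec \<in> Forms (+) (*\<^sub>R) S (Suc k)" using Forms_Pi_vec .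
    fix a assume "a \<in> S"
    then have "(kvec_of a, a) \<in> L" by (rule kvec_of_Lperp)
    then show "contr_vec Pv a = contr_vec Pi_vec a"
      using h contr_vec_Pi_vec unfolding is_Pi_vec_def by auto
  qed
next
  assume "Pv = Pi_vec"
  then show "is_Pi_vec k P Om Pv" unfolding is_Pi_vec_def using Forms_Pi_vec contr_vec_Pi_vec by auto
qed

lemma THE_is_Pi_vec: "(THE Pv. is_Pi_vec k P Om Pv) = Pi_vec"
  using is_Pi_vec_iff by simp

lemma Pi_vec_upd_last_perp:
  assumes \<zeta>: "\<And>w. w \<in> P \<Longrightarrow> \<zeta> \<bullet> w = 0"
  shows "(\<lambda>x. Pi_vec (x(k := \<zeta>))) = (\<lambda>x. 0)"
proof -
  have z: "\<zeta> \<in> S" using perp_in_S[OF \<zeta>] .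
  have "contr_vec Pi_vec \<zeta> = restrict_vec k P S (\<lambda>g. 0)" using contr_vec_Pi_vec[OF Lperp_vec_zero[OF \<zeta>]] .
  also have "\<dots> = (\<lambda>_. 0)" unfolding restrict_vec_def by auto
  finally have "(\<lambda>x. (-1) ^ k * Pi_vec (x(k := \<zeta>))) = (\<lambda>_. 0)"
    using contr_vec_eq_upd_last[OF Forms_Pi_vec S_subspace z] by simp
  then show ?thesis by (auto simp: fun_eq_iff)
qed

lemma contr_kvec_Pi_vec_perp:
  assumes W: "W \<in> Kvecs (+) (*\<^sub>R) S k" and \<zeta>: "\<And>w. w \<in> P \<Longrightarrow> \<zeta> \<bullet> w = 0"
  shows "contr_kvec k Pi_vec W (\<lambda>_. \<zeta>) = 0"
  unfolding contr_kvec_def using Pi_vec_upd_last_perp[OF \<zeta>] Kvecs_zero_form[OF W] by simp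

lemma contr_kvec_Pi_vec_riesz:
  assumes W: "W \<in> Kvecs (+) (*\<^sub>R) S k"
  obtains y where "y \<in> P" "\<And>\<zeta>. \<zeta> \<in> S \<Longrightarrow> contr_kvec k Pi_vec W (\<lambda>_. \<zeta>) = y \<bullet> \<zeta>"
proof -
  obtain y where y: "y \<in> S" "\<And>\<zeta>. \<zeta> \<in> S \<Longrightarrow> contr_kvec k Pi_vec W (\<lambda>_. \<zeta>) = y \<bullet> \<zeta>"
    using riesz_subspace[OF S_subspace, of "\<lambda>\<zeta>. contr_kvec k Pi_vec W (\<lambda>_. \<zeta>)"]
      contr_kvec_linear[OF Forms_Pi_vec S_subspace _ _ W] by metis
  have "y \<in> P"
  proof (rule in_subspace_if_orthogonal_perp[OF P_subspace])
    fix \<zeta> assume z: "\<And>w. w \<in> P \<Longrightarrow> \<zeta> \<bullet> w = 0"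
    show "y \<bullet> \<zeta> = 0" using y(2)[OF perp_in_S[OF z]] contr_kvec_Pi_vec_perp[OF W z] by simp
  qed
  then show ?thesis using that y(2) by blast
qed

lemma linear_dirac_dual: "linear_dirac (Suc k) S Pi_vec"
  unfolding linear_dirac_def
proof (simp only: diff_Suc_1, intro conjI allI impI S_subspace Forms_Pi_vec)
  fix Ws assume Ws: "\<forall>i<k. Ws i \<in> Kvecs (+) (*\<^sub>R) S k"
  have "\<forall>i. \<exists>y. i < k \<longrightarrow> y \<in> P \<and> (\<forall>\<zeta>\<in>S. contr_kvec k Pi_vec (Ws i) (\<lambda>_. \<zeta>) = y \<bullet> \<zeta>)"
    using Ws contr_kvec_Pi_vec_riesz by metis
  then obtain y where y: "\<And>i. i < k \<Longrightarrow> y i \<in> P"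
    "\<And>i \<zeta>. i < k \<Longrightarrow> \<zeta> \<in> S \<Longrightarrow> contr_kvec k Pi_vec (Ws i) (\<lambda>_. \<zeta>) = y i \<bullet> \<zeta>"
    by metis
  obtain a where a: "((\<lambda>g. g y), a) \<in> L" using Lperp_vec_exists[OF Kvecs_eval] by metis
  have "wedge_cov k (\<lambda>i. contr_kvec k Pi_vec (Ws i)) = gram_form k S y"
    using Ws y(2) by (intro wedge_contr_kvec_eq_gram_form[OF Forms_Pi_vec S_subspace]) auto
  also have "\<dots> = restrict_vec k P S (\<lambda>g. g y)"
    using y(1) by (intro restrict_vec_eval[symmetric]) blast
  also have "\<dots> = contr_vec Pi_vec a" using contr_vec_Pi_vec[OF a] by simp
  finally show "\<exists>v\<in>S. wedge_cov k (\<lambda>i. contr_kvec k Pi_vec (Ws i)) = contr_vec Pi_vec v"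
    using a unfolding S_vec_def by blast
qed

lemma S_vec_dual_subset: "S_vec k S Pi_vec \<subseteq> P"
proof
  interpret D: dirac k S Pi_vec using linear_dirac_dual by unfold_locales
  fix b assume "b \<in> S_vec k S Pi_vec"
  then obtain W where Wb: "(W, b) \<in> Lperp_vec k S Pi_vec" unfolding S_vec_def by auto
  show "b \<in> P"
  proof (rule in_subspace_if_orthogonal_perp[OF P_subspace])
    fix \<zeta> assume z: "\<And>w. w \<in> P \<Longrightarrow> \<zeta> \<bullet> w = 0"
    have "b \<bullet> \<zeta> = contr_kvec k Pi_vec W (\<lambda>_. \<zeta>)" using D.Lperp_vecD(2)[OF Wb perp_in_S[OF z]] by simp
    also have "\<dots> = 0" using contr_kvec_Pi_vec_perp[OF D.Lperp_vecD(1)[OF Wb] z] .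
    finally show "b \<bullet> \<zeta> = 0" .
  qed
qed

lemma Pi_vec_upd_last:
  assumes \<zeta>: "\<zeta> \<in> S" and J: "args_in S k J"
  shows "Pi_vec (J(k := \<zeta>)) = (-1) ^ k * kvec_of \<zeta> (gram_form k P J)"
proof -
  have "contr_vec Pi_vec \<zeta> J = (-1) ^ k * Pi_vec (J(k := \<zeta>))"
    using contr_vec_eq_upd_last[OF Forms_Pi_vec S_subspace \<zeta>] by simp
  moreover have "contr_vec Pi_vec \<zeta> J = kvec_of \<zeta> (gram_form k P J)"
    unfolding contr_vec_Pi_vec[OF kvec_of_Lperp[OF \<zeta>]] restrict_vec_def using J by simp
  ultimately have "(-1) ^ k * kvec_of \<zeta> (gram_form k P J) = ((-1) ^ k * (-1) ^ k) * Pi_vec (J(k := \<zeta>))"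
    by simp
  also have "((-1::real) ^ k * (-1) ^ k) = 1" by (simp add: power_mult_distrib[symmetric])
  finally show ?thesis by (simp add: fun_upd_def)
qed

lemma contr_vec_null_perp_S:
  assumes b: "b \<in> P" and \<kappa>: "\<kappa> \<in> P" and perp: "\<And>a. a \<in> S \<inter> P \<Longrightarrow> \<kappa> \<bullet> a = 0"
    and x: "args_in P k x" and i: "i < k"
  shows "contr_vec Om b (x(i := \<kappa>)) = 0"
proof -
  have null_last: "Om (z(k := \<kappa>)) = 0" if z: "args_in P k z" for z
  proof -
    obtain a where a: "a \<in> P" "((\<lambda>h. h z), a) \<in> L" using Lperp_vec_exists[OF Kvecs_eval] by metis
    have "a \<in> S" using a(2) unfolding S_vec_def by auto
    then have "\<kappa> \<bullet> a = 0" using perp a(1) by simp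
    moreover have "Om (z(k := \<kappa>)) = a \<bullet> \<kappa>"
      using Lperp_vecD(2)[OF a(2) \<kappa>] unfolding contr_kvec_def by simp
    ultimately show ?thesis by (simp add: inner_commute)
  qed
  have "contr_vec Om b (x(i := \<kappa>)) = Om ((insert_at 0 b x)(Suc i := \<kappa>))"
    unfolding contr_vec_insert_at by (rule arg_cong[where f = Om]) (auto simp: insert_at_def fun_eq_iff)
  also have "\<dots> = 0" using i
    by (intro form_null_vector_any_slot[OF Om_Forms P_subspace \<kappa> null_last args_in_insert_at[OF b x]]) auto
  finally show ?thesis .
qed

lemma subset_S_vec_dual:
  assumes b: "b \<in> P"
  shows "b \<in> S_vec k S Pi_vec"
proof -
  have "subspace (S \<inter> P)" using S_subspace P_subspace by (rule subspace_inter)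
  then obtain B where B: "B \<subseteq> S \<inter> P" "pairwise real_inner_class.orthogonal B" "\<And>x. x \<in> B \<Longrightarrow> norm x = 1"
    "independent B" "span B = S \<inter> P"
    using orthonormal_basis_subspace by metis
  have fB: "finite B" using B(4) independent_imp_finite by blast
  have BP: "B \<subseteq> P" using B(1) by blast
  let ?PJ = "PiE {..<k} (\<lambda>_. B)"
  define g where "g = contr_vec Om b"
  have g: "g \<in> Forms (+) (*\<^sub>R) P k" unfolding g_def by (rule Forms_contr_vec[OF Om_Forms P_subspace b])
  have null: "g (x(i := \<kappa>)) = 0"
    if "\<kappa> \<in> P" "\<And>q. q \<in> span B \<Longrightarrow> \<kappa> \<bullet> q = 0" "args_in P k x" "i < k" for \<kappa> x i
    unfolding g_def using that B(5) by (intro contr_vec_null_perp_S[OF b]) auto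
  have expansion: "(\<lambda>u. \<Sum>J\<in>?PJ. g J * gram_form k P J u) = (\<lambda>u. fact k * g u)"
    using sum_gram_form_expansion[OF g P_subspace fB BP B(2)] B(3) null by blast
  define W where "W = (\<lambda>h. \<Sum>J\<in>?PJ. (g J / fact k) * h J)"
  have W: "W \<in> Kvecs (+) (*\<^sub>R) S k" unfolding W_def
    by (rule Kvecs_sum_eval) (simp add: fB finite_PiE)
  have sign: "(-1::real) ^ k * (-1) ^ k = 1" by (simp add: power_mult_distrib[symmetric])
  have "contr_kvec k Pi_vec W (\<lambda>_. \<zeta>) = b \<bullet> \<zeta>" if \<zeta>: "\<zeta> \<in> S" for \<zeta>
  proof -
    have Z: "kvec_of \<zeta> \<in> Kvecs (+) (*\<^sub>R) P k" using Lperp_vecD(1)[OF kvec_of_Lperp[OF \<zeta>]] .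
    have "contr_kvec k Pi_vec W (\<lambda>_. \<zeta>) = (\<Sum>J\<in>?PJ. (g J / fact k) * Pi_vec (J(k := \<zeta>)))"
      unfolding contr_kvec_def W_def by simp
    also have "\<dots> = ((-1) ^ k / fact k) * (\<Sum>J\<in>?PJ. g J * kvec_of \<zeta> (gram_form k P J))"
      unfolding sum_distrib_left using B(1)
      by (intro sum.cong refl, subst Pi_vec_upd_last[OF \<zeta>]) (auto simp: PiE_def Pi_def)
    also have "(\<Sum>J\<in>?PJ. g J * kvec_of \<zeta> (gram_form k P J)) = kvec_of \<zeta> (\<lambda>u. fact k * g u)"
      unfolding expansion[symmetric]
      by (rule Kvecs_sum[OF Z, symmetric]) (auto simp: fB finite_PiE intro: Forms_gram_form[OF P_subspace])
    also have "\<dots> = fact k * kvec_of \<zeta> g" by (rule Kvecs_scale[OF Z g])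
    also have "kvec_of \<zeta> g = (-1) ^ k * (\<zeta> \<bullet> b)"
      unfolding g_def by (rule Lperp_vec_contr_vec[OF kvec_of_Lperp[OF \<zeta>] b])
    finally show ?thesis using sign by (simp add: inner_commute)
  qed
  then have "(W, b) \<in> Lperp_vec k S Pi_vec" using W by (simp add: Lperp_vec_def)
  then show ?thesis unfolding S_vec_def by blast
qed

lemma S_vec_dual: "S_vec k S Pi_vec = P" using S_vec_dual_subset subset_S_vec_dual by blast

lemma is_Pi_vec_dual: "is_Pi_vec k S Pi_vec Om"
  unfolding is_Pi_vec_def S_vec_dual
proof (intro conjI Om_Forms ballI)
  interpret D: dirac k S Pi_vec using linear_dirac_dual by unfold_locales
  fix Wb assume "Wb \<in> Lperp_vec k S Pi_vec"
  then obtain W b where Wb: "(W, b) \<in> Lperp_vec k S Pi_vec" and Wb': "Wb = (W, b)" by (cases Wb) auto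
  have b: "b \<in> P" using Wb S_vec_dual unfolding S_vec_def by auto
  have "contr_vec Om b = restrict_vec k S P W"
  proof
    fix u
    show "contr_vec Om b u = restrict_vec k S P W u"
    proof (cases "args_in P k u")
      case True
      obtain \<zeta> where z: "\<zeta> \<in> P" "((\<lambda>h. h u), \<zeta>) \<in> L" using Lperp_vec_exists[OF Kvecs_eval] by metis
      have zS: "\<zeta> \<in> S" using z unfolding S_vec_def by auto
      have hD: "gram_form k S u = contr_vec Pi_vec \<zeta>"
        using contr_vec_Pi_vec[OF z(2)] restrict_vec_eval[OF True] by simp
      have "restrict_vec k S P W u = W (gram_form k S u)" unfolding restrict_vec_def using True by simp
      also have "\<dots> = (-1) ^ k * (b \<bullet> \<zeta>)" unfolding hD by (rule D.Lperp_vec_contr_vec[OF Wb zS])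
      also have "b \<bullet> \<zeta> = Om (u(k := b))"
        using Lperp_vecD(2)[OF z(2) b] unfolding contr_kvec_def by (simp add: inner_commute)
      finally show ?thesis using contr_vec_eq_upd_last[OF Om_Forms P_subspace b] by simp
    next
      case False
      have "restrict_vec k S P W u = 0" unfolding restrict_vec_def by (rule if_not_P[OF False])
      moreover have "contr_vec Om b u = 0"
        unfolding contr_vec_insert_at using Forms_vanish[OF Om_Forms not_args_in_insert_at[OF False]] by simp
      ultimately show ?thesis by simp
    qed
  qed
  then show "case Wb of (Z, a) \<Rightarrow> contr_vec Om a = restrict_vec k S P Z" unfolding Wb' by simp
qed

end

section \<open>Identification of covectors with vectors\<close>

definition vec_of :: "('v::real_inner \<Rightarrow> real) \<Rightarrow> 'v" where "vec_of \<eta> = (SOME a. inner a = \<eta>)"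

lemma inner_left_inj: "inner a = (inner b :: 'v::real_inner \<Rightarrow> real) \<Longrightarrow> a = b"
proof -
  assume "inner a = inner b"
  then have "inner a (a - b) = inner b (a - b)" by simp
  then have "(a - b) \<bullet> (a - b) = 0" by (simp add: inner_diff_left)
  then show "a = b" by simp
qed

lemma vec_of_inner[simp]: "vec_of (inner a) = a"
  unfolding vec_of_def by (rule some_equality) (auto dest: inner_left_inj)

lemma inner_vec_of: "\<eta> \<in> range inner \<Longrightarrow> inner (vec_of \<eta>) = \<eta>"
  by auto

lemma linear_inner: "linear (inner a)"
  using bounded_linear_inner_right[of a] bounded_linear.linear by blast

lemma linear_in_range_inner:
  fixes \<eta> :: "'v::euclidean_space \<Rightarrow> real"
  assumes l: "linear \<eta>"
  shows "\<eta> \<in> range inner"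
proof -
  have "\<eta> = inner (\<Sum>b\<in>Basis. \<eta> b *\<^sub>R b)"
  proof
    fix x :: 'v
    have "\<eta> x = \<eta> (\<Sum>b\<in>Basis. (x \<bullet> b) *\<^sub>R b)" by (simp add: euclidean_representation)
    also have "\<dots> = (\<Sum>b\<in>Basis. (x \<bullet> b) * \<eta> b)"
      using l by (simp add: linear_sum linear_scale)
    also have "\<dots> = (\<Sum>b\<in>Basis. \<eta> b *\<^sub>R b) \<bullet> x"
      by (simp add: inner_sum_right inner_commute mult.commute)
    finally show "\<eta> x = inner (\<Sum>b\<in>Basis. \<eta> b *\<^sub>R b) x" by simp
  qed
  then show ?thesis by blast
qed

lemma cadd_csc_inner: "cadd (csc c (inner a)) (inner b) = inner (c *\<^sub>R a + b)"
  unfolding cadd_def csc_def by (auto simp: fun_eq_iff inner_add_left)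

definition pull_form :: "((nat \<Rightarrow> ('v \<Rightarrow> real)) \<Rightarrow> real) \<Rightarrow> (nat \<Rightarrow> 'v::real_inner) \<Rightarrow> real" where
  "pull_form f = (\<lambda>x. f (\<lambda>i. inner (x i)))"

text \<open>Arguments outside range inner are sent to 0, since forms vanish off their domain.\<close>

definition push_form :: "nat \<Rightarrow> ((nat \<Rightarrow> 'v) \<Rightarrow> real) \<Rightarrow> (nat \<Rightarrow> ('v::real_inner \<Rightarrow> real)) \<Rightarrow> real" where
  "push_form n g = (\<lambda>\<xi>. if args_in (range inner) n \<xi> then g (\<lambda>i. vec_of (\<xi> i)) else 0)"

lemma push_form_apply: "args_in (range inner) n \<xi> \<Longrightarrow> push_form n g \<xi> = g (\<lambda>i. vec_of (\<xi> i))"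
  unfolding push_form_def by (rule if_P)

lemma push_form_vanish: "\<not> args_in (range inner) n \<xi> \<Longrightarrow> push_form n g \<xi> = 0"
  unfolding push_form_def by (rule if_not_P)

lemma inner_in_image_iff: "inner a \<in> inner ` S \<longleftrightarrow> a \<in> S"
  using inner_left_inj by blast

lemma inner_vimage_image: "inner -` (inner ` (A :: 'v::real_inner set)) = A"
  using inner_left_inj by blast

lemma inner_comp_upd: "(\<lambda>i. inner ((x(j := y)) i)) = (\<lambda>i. inner (x i))(j := inner y)"
  by (auto simp: fun_eq_iff)

lemma Forms_pull_form:
  assumes f: "f \<in> Forms cadd csc (inner ` S') n"
  shows "pull_form f \<in> Forms (+) (*\<^sub>R) S' n"
  unfolding Forms_def altform_def pull_form_def
proof (intro CollectI conjI allI impI)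
  fix x y :: "nat \<Rightarrow> 'a" assume "\<forall>i<n. x i = y i"
  then show "f (\<lambda>i. inner (x i)) = f (\<lambda>i. inner (y i))" by (intro Forms_cong[OF f]) auto
next
  fix x :: "nat \<Rightarrow> 'a" assume "\<not> args_in S' n x"
  then have "\<not> args_in (inner ` S') n (\<lambda>i. inner (x i))" using inner_in_image_iff by metis
  then show "f (\<lambda>i. inner (x i)) = 0" by (rule Forms_vanish[OF f])
next
  fix x :: "nat \<Rightarrow> 'a" and i a b c
  assume h: "args_in S' n x \<and> i < n \<and> a \<in> S' \<and> b \<in> S'"
  have "f ((\<lambda>i. inner (x i))(i := cadd (csc c (inner a)) (inner b))) =
      c * f ((\<lambda>i. inner (x i))(i := inner a)) + f ((\<lambda>i. inner (x i))(i := inner b))"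
    using h by (intro Forms_linear[OF f]) auto
  then show "f (\<lambda>j. inner ((x(i := c *\<^sub>R a + b)) j)) =
      c * f (\<lambda>j. inner ((x(i := a)) j)) + f (\<lambda>j. inner ((x(i := b)) j))"
    unfolding inner_comp_upd cadd_csc_inner .
next
  fix x :: "nat \<Rightarrow> 'a" and i j
  assume h: "args_in S' n x \<and> i < n \<and> j < n \<and> i \<noteq> j \<and> x i = x j"
  then show "f (\<lambda>i. inner (x i)) = 0"
    by (intro Forms_alternating[OF f, of _ i j]) auto
qed

lemma push_form_upd:
  assumes "args_in (range inner) n \<xi>" "i < n" "z \<in> range inner"
  shows "push_form n g (\<xi>(i := z)) = g ((\<lambda>j. vec_of (\<xi> j))(i := vec_of z))"
  unfolding push_form_def using assms by (auto simp: fun_upd_def intro!: arg_cong[where f=g])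

lemma Forms_push_form:
  assumes g: "g \<in> Forms (+) (*\<^sub>R) S' n"
  shows "push_form n g \<in> Forms cadd csc (inner ` S') n"
  unfolding Forms_def altform_def
proof (intro CollectI conjI allI impI)
  fix x y :: "nat \<Rightarrow> 'a \<Rightarrow> real" assume h: "\<forall>i<n. x i = y i"
  then have "args_in (range inner) n x = args_in (range inner) n y" by auto
  moreover have "g (\<lambda>i. vec_of (x i)) = g (\<lambda>i. vec_of (y i))" using h by (intro Forms_cong[OF g]) auto
  ultimately show "push_form n g x = push_form n g y" unfolding push_form_def by (simp only:)
next
  fix x :: "nat \<Rightarrow> 'a \<Rightarrow> real" assume h: "\<not> args_in (inner ` S') n x"
  show "push_form n g x = 0"
  proof (cases "args_in (range inner) n x")
    case True
    then have "\<not> args_in S' n (\<lambda>i. vec_of (x i))" using h by (metis image_eqI inner_vec_of)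
    then show ?thesis unfolding push_form_def using Forms_vanish[OF g] by simp
  next
    case False
    then show ?thesis unfolding push_form_def by (rule if_not_P)
  qed
next
  fix x :: "nat \<Rightarrow> 'a \<Rightarrow> real" and i a b c
  assume h: "args_in (inner ` S') n x \<and> i < n \<and> a \<in> inner ` S' \<and> b \<in> inner ` S'"
  then obtain a' b' where ab: "a = inner a'" "b = inner b'" "a' \<in> S'" "b' \<in> S'" by auto
  have x: "args_in (range inner) n x" using h by auto
  have xd: "args_in S' n (\<lambda>j. vec_of (x j))" using h by auto
  have "g ((\<lambda>j. vec_of (x j))(i := c *\<^sub>R a' + b'))
      = c * g ((\<lambda>j. vec_of (x j))(i := a')) + g ((\<lambda>j. vec_of (x j))(i := b'))"
    using xd h ab by (intro Forms_linear[OF g]) auto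
  then show "push_form n g (x(i := cadd (csc c a) b))
      = c * push_form n g (x(i := a)) + push_form n g (x(i := b))"
    unfolding ab cadd_csc_inner using push_form_upd[OF x] h by simp
next
  fix x :: "nat \<Rightarrow> 'a \<Rightarrow> real" and i j
  assume h: "args_in (inner ` S') n x \<and> i < n \<and> j < n \<and> i \<noteq> j \<and> x i = x j"
  then have "args_in (range inner) n x" "args_in S' n (\<lambda>j. vec_of (x j))" by auto
  moreover have "g (\<lambda>j. vec_of (x j)) = 0" using h \<open>args_in S' n (\<lambda>j. vec_of (x j))\<close>
    by (intro Forms_alternating[OF g, of _ i j]) auto
  ultimately show "push_form n g x = 0" unfolding push_form_def by simp
qed

lemma push_pull_form:
  assumes f: "f \<in> Forms cadd csc (inner ` S') n"
  shows "push_form n (pull_form f) = f"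
proof
  fix \<xi>
  show "push_form n (pull_form f) \<xi> = f \<xi>"
  proof (cases "args_in (range inner) n \<xi>")
    case True
    then show ?thesis unfolding push_form_def pull_form_def by (auto intro!: Forms_cong[OF f])
  next
    case False
    then have "\<not> args_in (inner ` S') n \<xi>" by auto
    then show ?thesis unfolding push_form_def using False Forms_vanish[OF f] by auto
  qed
qed

lemma pull_push_form: "pull_form (push_form n g) = g"
  unfolding pull_form_def push_form_def by auto

lemma push_form_lincomb: "push_form n (\<lambda>x. c * g x + h x) = (\<lambda>\<xi>. c * push_form n g \<xi> + push_form n h \<xi>)"
  unfolding push_form_def by (auto simp: fun_eq_iff)

lemma Kvecs_comp_push_form:
  assumes Z: "Z \<in> Kvecs cadd csc (inner ` S') n"
  shows "(\<lambda>g. Z (push_form n g)) \<in> Kvecs (+) (*\<^sub>R) S' n"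
  unfolding Kvecs_def
proof (intro CollectI ballI allI)
  fix f g c assume "f \<in> Forms (+) (*\<^sub>R) S' n" "g \<in> Forms (+) (*\<^sub>R) S' n"
  then show "Z (push_form n (\<lambda>x. c * f x + g x)) = c * Z (push_form n f) + Z (push_form n g)"
    unfolding push_form_lincomb by (intro Kvecs_linear[OF Z] Forms_push_form)
qed

lemma Kvecs_comp_pull_form:
  assumes W: "W \<in> Kvecs (+) (*\<^sub>R) S' n"
  shows "(\<lambda>f. W (pull_form f)) \<in> Kvecs cadd csc (inner ` S') n"
  unfolding Kvecs_def
proof (intro CollectI ballI allI)
  fix f g c assume "f \<in> Forms cadd csc (inner ` S') n" "g \<in> Forms cadd csc (inner ` S') n"
  moreover have "pull_form (\<lambda>x. c * f x + g x) = (\<lambda>x. c * pull_form f x + pull_form g x)"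
    unfolding pull_form_def ..
  ultimately show "W (pull_form (\<lambda>x. c * f x + g x)) = c * W (pull_form f) + W (pull_form g)"
    by (simp only:) (intro Kvecs_linear[OF W] Forms_pull_form)
qed

lemma contr_vec_pull_form: "contr_vec (pull_form Pv) a x = contr_vec Pv (inner a) (\<lambda>i. inner (x i))"
  unfolding contr_vec_def pull_form_def by (auto intro!: arg_cong[where f=Pv])

lemma push_form_upd_last:
  fixes y :: "'v::real_inner"
  shows "push_form k (\<lambda>x. g (x(k := y))) = (\<lambda>\<xi>. push_form (Suc k) g (\<xi>(k := inner y)))"
proof
  fix \<xi> :: "nat \<Rightarrow> 'v \<Rightarrow> real"
  show "push_form k (\<lambda>x. g (x(k := y))) \<xi> = push_form (Suc k) g (\<xi>(k := inner y))"
  proof (cases "args_in (range inner) k \<xi>")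
    case True
    then have r: "args_in (range inner) (Suc k) (\<xi>(k := inner y))" by (auto simp: fun_upd_def)
    have "(\<lambda>i. vec_of ((\<xi>(k := inner y)) i)) = (\<lambda>i. vec_of (\<xi> i))(k := y)" by (auto simp: fun_eq_iff)
    then show ?thesis unfolding push_form_def if_P[OF True] if_P[OF r] by simp
  next
    case False
    then have r: "\<not> args_in (range inner) (Suc k) (\<xi>(k := inner y))" by (auto simp: fun_upd_def)
    show ?thesis unfolding push_form_def if_not_P[OF False] if_not_P[OF r] ..
  qed
qed

lemma contr_kvec_push_form:
  assumes "\<eta> \<in> range inner"
  shows "contr_kvec k (push_form (Suc k) g) Z (\<lambda>_. \<eta>) = contr_kvec k g (\<lambda>h. Z (push_form k h)) (\<lambda>_. vec_of \<eta>)"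
proof -
  obtain y where \<eta>: "\<eta> = inner y" using assms by blast
  show ?thesis unfolding \<eta> vec_of_inner contr_kvec_def push_form_upd_last by (rule refl)
qed

lemma contr_vec_push_form:
  fixes a :: "'v::real_inner"
  shows "contr_vec (push_form (Suc k) g) (inner a) = push_form k (contr_vec g a)"
proof
  fix \<xi> :: "nat \<Rightarrow> 'v \<Rightarrow> real"
  let ?\<xi>a = "\<lambda>i. if i = 0 then inner a else \<xi> (i - 1)"
  show "contr_vec (push_form (Suc k) g) (inner a) \<xi> = push_form k (contr_vec g a) \<xi>"
  proof (cases "args_in (range inner) k \<xi>")
    case True
    then have r: "args_in (range inner) (Suc k) ?\<xi>a" by (auto simp: less_Suc_eq_0_disj)
    have "(\<lambda>i. vec_of (?\<xi>a i)) = (\<lambda>i. if i = 0 then a else vec_of (\<xi> (i - 1)))" by (auto simp: fun_eq_iff)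
    then show ?thesis unfolding contr_vec_def push_form_def if_P[OF True] if_P[OF r] by simp
  next
    case False
    then obtain j where "j < k" "\<xi> j \<notin> range inner" by auto
    then have r: "\<not> args_in (range inner) (Suc k) ?\<xi>a" by (auto intro!: exI[of _ "Suc j"])
    show ?thesis unfolding contr_vec_def push_form_def if_not_P[OF False] if_not_P[OF r] ..
  qed
qed

lemma wedge_contr_kvec_push_form:
  fixes g :: "(nat \<Rightarrow> 'v::real_inner) \<Rightarrow> real"
  assumes w: "\<And>i. i < k \<Longrightarrow> w i \<in> Kvecs cadd csc U k"
  shows "wedge_cov k (\<lambda>i. contr_kvec k (push_form (Suc k) g) (w i))
    = push_form k (wedge_cov k (\<lambda>i. contr_kvec k g (\<lambda>h. w i (push_form k h))))"
proof
  fix \<xi> :: "nat \<Rightarrow> 'v \<Rightarrow> real"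
  show "wedge_cov k (\<lambda>i. contr_kvec k (push_form (Suc k) g) (w i)) \<xi>
    = push_form k (wedge_cov k (\<lambda>i. contr_kvec k g (\<lambda>h. w i (push_form k h)))) \<xi>"
  proof (cases "args_in (range inner) k \<xi>")
    case True
    show ?thesis unfolding push_form_apply[OF True] wedge_cov_def
    proof (intro sum.cong refl arg_cong[where f="\<lambda>x. _ * x"] prod.cong)
      fix \<sigma> i assume s: "\<sigma> \<in> {\<sigma>. \<sigma> permutes {..<k}}" and i: "i \<in> {..<k}"
      have "\<sigma> permutes {..<k}" "i < k" using s i by auto
      then have "\<sigma> i < k" by (meson lessThan_iff permutes_in_image)
      then show "contr_kvec k (push_form (Suc k) g) (w i) (\<lambda>_. \<xi> (\<sigma> i))
        = contr_kvec k g (\<lambda>h. w i (push_form k h)) (\<lambda>_. vec_of (\<xi> (\<sigma> i)))"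
        using True by (intro contr_kvec_push_form) auto
    qed
  next
    case False
    then obtain j where j: "j < k" "\<xi> j \<notin> range inner" by auto
    have zero: "(\<lambda>\<xi>'. push_form (Suc k) g (\<xi>'(k := \<xi> j))) = (\<lambda>_. 0)"
    proof
      fix \<xi>' :: "nat \<Rightarrow> 'v \<Rightarrow> real"
      have "\<not> args_in (range inner) (Suc k) (\<xi>'(k := \<xi> j))" using j by (auto intro!: exI[of _ k])
      then show "push_form (Suc k) g (\<xi>'(k := \<xi> j)) = 0" by (rule push_form_vanish)
    qed
    have "wedge_cov k (\<lambda>i. contr_kvec k (push_form (Suc k) g) (w i)) \<xi> = 0"
    proof (rule wedge_cov_zero_column[OF j(1)])
      fix i assume "i < k"
      then show "contr_kvec k (push_form (Suc k) g) (w i) (\<lambda>_. \<xi> j) = 0"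
        unfolding contr_kvec_def zero by (rule Kvecs_zero_form[OF w])
    qed
    then show ?thesis unfolding push_form_vanish[OF False] .
  qed
qed

lemma dual_subspace_eq_image_vimage:
  fixes S :: "('v::euclidean_space \<Rightarrow> real) set"
  assumes "dual_subspace S"
  shows "S = inner ` (inner -` S)"
proof -
  have "S \<subseteq> range inner" using assms linear_in_range_inner unfolding dual_subspace_def by blast
  then show ?thesis by auto
qed

lemma subspace_vimage_inner:
  fixes S :: "('v::real_inner \<Rightarrow> real) set"
  assumes S: "dual_subspace S"
  shows "subspace (inner -` S)"
proof -
  have lin: "cadd (csc c f) g \<in> S" if "f \<in> S" "g \<in> S" for c f g
    using S that unfolding dual_subspace_def by blast
  have "inner (0::'v) = (\<lambda>_. 0)" by (simp add: fun_eq_iff)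
  then have z: "inner (0::'v) \<in> S" using S unfolding dual_subspace_def by simp
  show ?thesis unfolding subspace_def
  proof (intro conjI ballI allI)
    show "(0::'v) \<in> inner -` S" using z by simp
    fix x y :: 'v assume "x \<in> inner -` S" "y \<in> inner -` S"
    then show "x + y \<in> inner -` S" using lin[of "inner x" "inner y" 1] cadd_csc_inner[of 1 x y] by simp
  next
    fix c and x :: 'v assume "x \<in> inner -` S"
    then show "c *\<^sub>R x \<in> inner -` S" using lin[OF _ z, of "inner x" c] cadd_csc_inner[of c x 0] by simp
  qed
qed

lemma dual_subspace_image_inner:
  fixes S' :: "'v::euclidean_space set"
  assumes S': "subspace S'"
  shows "dual_subspace (inner ` S')"
  unfolding dual_subspace_def
proof (intro conjI ballI allI)
  show "inner ` S' \<subseteq> {f. linear f}" using linear_inner by auto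
  have "(\<lambda>_. 0) = inner (0::'v)" by (simp add: fun_eq_iff)
  then show "(\<lambda>_. 0) \<in> inner ` S'" using S' by (simp add: subspace_0)
  fix f g c assume "f \<in> inner ` S'" "g \<in> inner ` S'"
  then obtain a b where ab: "f = inner a" "g = inner b" "a \<in> S'" "b \<in> S'" by auto
  then have "c *\<^sub>R a + b \<in> S'" using S' by (simp add: subspace_add subspace_scale)
  then show "cadd (csc c f) g \<in> inner ` S'" unfolding ab cadd_csc_inner by (rule imageI)
qed

lemma linear_dirac_pull_form:
  fixes S' :: "'v::euclidean_space set"
  assumes H: "condH' (Suc k) S Pv" and SS: "S = inner ` S'" and S': "subspace S'"
  shows "linear_dirac (Suc k) S' (pull_form Pv)"
proof -
  have Pv: "Pv \<in> Forms cadd csc S (Suc k)" using H unfolding condH'_def by simp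
  have H': "\<And>w. (\<forall>i<k. w i \<in> Kvecs cadd csc S k) \<Longrightarrow>
     \<exists>\<eta>\<in>S. wedge_cov k (\<lambda>i. contr_kvec k Pv (w i)) = contr_vec Pv \<eta>"
    using H unfolding condH'_def by simp
  show ?thesis unfolding linear_dirac_def
  proof (simp only: diff_Suc_1, intro conjI allI impI)
    show "subspace S'" by fact
    show "pull_form Pv \<in> Forms (+) (*\<^sub>R) S' (Suc k)" using Forms_pull_form Pv SS by simp
    fix W assume W: "\<forall>i<k. W i \<in> Kvecs (+) (*\<^sub>R) S' k"
    define w where "w i = (\<lambda>f. W i (pull_form f))" for i
    have w: "\<forall>i<k. w i \<in> Kvecs cadd csc S k" unfolding w_def SS using W Kvecs_comp_pull_form by blast
    obtain \<eta> where \<eta>: "\<eta> \<in> S" "wedge_cov k (\<lambda>i. contr_kvec k Pv (w i)) = contr_vec Pv \<eta>"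
      using H'[OF w] by blast
    then obtain a where a: "a \<in> S'" "\<eta> = inner a" using SS by auto
    have c: "contr_kvec k (pull_form Pv) (W i) (\<lambda>_. y) = contr_kvec k Pv (w i) (\<lambda>_. inner y)" for i y
    proof -
      have "pull_form (\<lambda>x. Pv (x(k := inner y))) = (\<lambda>x. pull_form Pv (x(k := y)))"
        unfolding pull_form_def inner_comp_upd ..
      then show ?thesis unfolding contr_kvec_def w_def by simp
    qed
    have "wedge_cov k (\<lambda>i. contr_kvec k (pull_form Pv) (W i)) = contr_vec (pull_form Pv) a"
    proof
      fix x
      have "wedge_cov k (\<lambda>i. contr_kvec k (pull_form Pv) (W i)) x
          = wedge_cov k (\<lambda>i. contr_kvec k Pv (w i)) (\<lambda>i. inner (x i))"
        unfolding wedge_cov_def c ..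
      also have "\<dots> = contr_vec Pv \<eta> (\<lambda>i. inner (x i))" using \<eta>(2) by simp
      also have "\<dots> = contr_vec (pull_form Pv) a x" unfolding contr_vec_pull_form a(2) ..
      finally show "wedge_cov k (\<lambda>i. contr_kvec k (pull_form Pv) (W i)) x = contr_vec (pull_form Pv) a x" .
    qed
    then show "\<exists>v\<in>S'. wedge_cov k (\<lambda>i. contr_kvec k (pull_form Pv) (W i)) = contr_vec (pull_form Pv) v"
      using a by blast
  qed
qed

lemma condH'_push_form:
  fixes S' :: "'v::euclidean_space set"
  assumes LD: "linear_dirac (Suc k) S' g"
  shows "condH' (Suc k) (inner ` S') (push_form (Suc k) g)"
proof -
  have S': "subspace S'" and g: "g \<in> Forms (+) (*\<^sub>R) S' (Suc k)"
    using LD unfolding linear_dirac_def by auto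
  have H: "\<And>Zs. (\<forall>i<k. Zs i \<in> Kvecs (+) (*\<^sub>R) S' k) \<Longrightarrow>
     \<exists>v\<in>S'. wedge_cov k (\<lambda>i. contr_kvec k g (Zs i)) = contr_vec g v"
    using LD unfolding linear_dirac_def by simp
  show ?thesis unfolding condH'_def
  proof (simp only: diff_Suc_1, intro conjI allI impI dual_subspace_image_inner[OF S'] Forms_push_form[OF g])
    fix w assume w: "\<forall>i<k. w i \<in> Kvecs cadd csc (inner ` S') k"
    then have "\<forall>i<k. (\<lambda>h. w i (push_form k h)) \<in> Kvecs (+) (*\<^sub>R) S' k"
      using Kvecs_comp_push_form by blast
    from H[OF this] obtain a where a: "a \<in> S'"
      "wedge_cov k (\<lambda>i. contr_kvec k g (\<lambda>h. w i (push_form k h))) = contr_vec g a"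
      by blast
    have "wedge_cov k (\<lambda>i. contr_kvec k (push_form (Suc k) g) (w i)) = push_form k (contr_vec g a)"
      using w by (subst wedge_contr_kvec_push_form) (auto simp: a(2))
    also have "\<dots> = contr_vec (push_form (Suc k) g) (inner a)" by (rule contr_vec_push_form[symmetric])
    finally show "\<exists>\<eta>\<in>inner ` S'. wedge_cov k (\<lambda>i. contr_kvec k (push_form (Suc k) g) (w i))
        = contr_vec (push_form (Suc k) g) \<eta>"
      using a(1) by blast
  qed
qed

lemma wedge_cov_cong: "(\<And>i. i < k \<Longrightarrow> F i = G i) \<Longrightarrow> wedge_cov k F = wedge_cov k G"
  unfolding wedge_cov_def by (auto intro!: sum.cong prod.cong)

lemma restrict_kvec_cong: "(\<And>i. i < k \<Longrightarrow> \<xi> i = \<xi>' i) \<Longrightarrow> restrict_kvec k P S Z \<xi> = restrict_kvec k P S Z \<xi>'"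
proof -
  assume h: "\<And>i. i < k \<Longrightarrow> \<xi> i = \<xi>' i"
  then have "wedge_cov k (\<lambda>i y. \<xi> i (y 0)) = wedge_cov k (\<lambda>i y. \<xi>' i (y 0))" by (intro wedge_cov_cong) auto
  moreover have "args_in S k \<xi> = args_in S k \<xi>'" using h by auto
  ultimately show ?thesis unfolding restrict_kvec_def by (simp only:)
qed

lemma restrict_kvec_inner: "restrict_kvec k P (inner ` S) Z (\<lambda>i. inner (x i)) = restrict_vec k P S Z x"
proof -
  have "(\<forall>i<k. inner (x i) \<in> inner ` S) = args_in S k x" by (simp add: inner_in_image_iff)
  moreover have "(\<lambda>u. if args_in P k u then wedge_cov k (\<lambda>i y. inner (x i) (y 0)) u else 0) = gram_form k P x"
    unfolding gram_form_def gram_det_def ..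
  ultimately show ?thesis unfolding restrict_kvec_def restrict_vec_def by (simp only:)
qed

lemma push_form_restrict_vec:
  fixes S :: "'v::real_inner set"
  shows "push_form k (restrict_vec k P S Z) = restrict_kvec k P (inner ` S) Z"
proof
  fix \<xi> :: "nat \<Rightarrow> 'v \<Rightarrow> real"
  show "push_form k (restrict_vec k P S Z) \<xi> = restrict_kvec k P (inner ` S) Z \<xi>"
  proof (cases "args_in (range inner) k \<xi>")
    case True
    have "restrict_vec k P S Z (\<lambda>i. vec_of (\<xi> i))
        = restrict_kvec k P (inner ` S) Z (\<lambda>i. inner (vec_of (\<xi> i)))"
      by (rule restrict_kvec_inner[symmetric])
    also have "\<dots> = restrict_kvec k P (inner ` S) Z \<xi>" using True by (intro restrict_kvec_cong) auto
    finally show ?thesis unfolding push_form_def if_P[OF True] .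
  next
    case False
    then have n: "\<not> args_in (inner ` S) k \<xi>" by auto
    show ?thesis unfolding push_form_def restrict_kvec_def if_not_P[OF False] if_not_P[OF n] ..
  qed
qed

context dirac begin

lemma Lperp_iff_Lperp_vec: "(Z, \<eta>) \<in> Lperp (Suc k) P Om \<longleftrightarrow> (\<exists>a. \<eta> = inner a \<and> (Z, a) \<in> L)"
proof
  assume h: "(Z, \<eta>) \<in> Lperp (Suc k) P Om"
  then have "linear \<eta>" unfolding Lperp_def by simp
  then obtain a where a: "\<eta> = inner a" using linear_in_range_inner by blast
  then show "\<exists>a. \<eta> = inner a \<and> (Z, a) \<in> L" using h unfolding Lperp_def Lperp_vec_def by auto
next
  assume "\<exists>a. \<eta> = inner a \<and> (Z, a) \<in> L"
  then show "(Z, \<eta>) \<in> Lperp (Suc k) P Om" unfolding Lperp_def Lperp_vec_def using linear_inner by auto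
qed

lemma S_of_eq_image: "S_of (Suc k) P Om = inner ` S"
  unfolding S_of_def S_vec_def using Lperp_iff_Lperp_vec by auto

lemma is_Pi_of_iff: "is_Pi_of (Suc k) P Om Pv \<longleftrightarrow> Pv = push_form (Suc k) Pi_vec"
proof
  assume h: "is_Pi_of (Suc k) P Om Pv"
  have Pv: "Pv \<in> Forms cadd csc (inner ` S) (Suc k)" using h unfolding is_Pi_of_def S_of_eq_image by simp
  have pairs: "\<And>Z \<eta>. (Z, \<eta>) \<in> Lperp (Suc k) P Om \<Longrightarrow> contr_vec Pv \<eta> = restrict_kvec k P (inner ` S) Z"
    using h unfolding is_Pi_of_def S_of_eq_image by auto
  have "is_Pi_vec k P Om (pull_form Pv)" unfolding is_Pi_vec_def
  proof (intro conjI Forms_pull_form[OF Pv] ballI)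
    fix Za assume "Za \<in> L"
    then obtain Z a where Za: "(Z, a) \<in> L" "Za = (Z, a)" by (cases Za) auto
    have "(Z, inner a) \<in> Lperp (Suc k) P Om" using Lperp_iff_Lperp_vec Za by auto
    then have e: "contr_vec Pv (inner a) = restrict_kvec k P (inner ` S) Z" by (rule pairs)
    have "contr_vec (pull_form Pv) a = restrict_vec k P S Z"
    proof
      fix x show "contr_vec (pull_form Pv) a x = restrict_vec k P S Z x"
        unfolding contr_vec_pull_form e restrict_kvec_inner ..
    qed
    then show "case Za of (Z, a) \<Rightarrow> contr_vec (pull_form Pv) a = restrict_vec k P S Z" using Za by simp
  qed
  then have "pull_form Pv = Pi_vec" using is_Pi_vec_iff by blast
  then show "Pv = push_form (Suc k) Pi_vec" using push_pull_form[OF Pv] by simp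
next
  assume h: "Pv = push_form (Suc k) Pi_vec"
  show "is_Pi_of (Suc k) P Om Pv" unfolding is_Pi_of_def S_of_eq_image diff_Suc_1
  proof (intro conjI ballI)
    show "Pv \<in> Forms cadd csc (inner ` S) (Suc k)" unfolding h by (rule Forms_push_form[OF Forms_Pi_vec])
    fix Z\<eta> assume "Z\<eta> \<in> Lperp (Suc k) P Om"
    then obtain Z a where Z\<eta>: "Z\<eta> = (Z, inner a)" and Za: "(Z, a) \<in> L"
      using Lperp_iff_Lperp_vec by (cases Z\<eta>) auto
    have "contr_vec (push_form (Suc k) Pi_vec) (inner a) = push_form k (contr_vec Pi_vec a)"
      by (rule contr_vec_push_form)
    also have "\<dots> = restrict_kvec k P (inner ` S) Z"
      unfolding contr_vec_Pi_vec[OF Za] by (rule push_form_restrict_vec)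
    finally show "case Z\<eta> of (Z, \<eta>) \<Rightarrow> contr_vec Pv \<eta> = restrict_kvec k P (inner ` S) Z"
      unfolding Z\<eta> h by simp
  qed
qed

lemma ex1_is_Pi_of: "\<exists>!Pv. is_Pi_of (Suc k) P Om Pv"
  by (rule ex1I[of _ "push_form (Suc k) Pi_vec"]) (auto simp: is_Pi_of_iff)

lemma dirac_to_pair_eq: "dirac_to_pair (Suc k) (P, Om) = (inner ` S, push_form (Suc k) Pi_vec)"
proof -
  have "(THE Pv. is_Pi_of (Suc k) P Om Pv) = push_form (Suc k) Pi_vec"
    by (rule the_equality) (auto simp: is_Pi_of_iff)
  then show ?thesis unfolding dirac_to_pair_def by (simp add: S_of_eq_image)
qed

end

section \<open>The correspondence\<close>

definition dual_pair ::
  "nat \<Rightarrow> 'v::real_inner set \<times> ((nat \<Rightarrow> 'v) \<Rightarrow> real) \<Rightarrow> 'v set \<times> ((nat \<Rightarrow> 'v) \<Rightarrow> real)"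
  where "dual_pair k = (\<lambda>(P, Om). (S_vec k P Om, THE Pv. is_Pi_vec k P Om Pv))"

definition covector_pair :: "nat \<Rightarrow> 'v::real_inner set \<times> ((nat \<Rightarrow> 'v) \<Rightarrow> real)
    \<Rightarrow> ('v \<Rightarrow> real) set \<times> ((nat \<Rightarrow> ('v \<Rightarrow> real)) \<Rightarrow> real)"
  where "covector_pair n = (\<lambda>(S', g). (inner ` S', push_form n g))"

context dirac begin

lemma dual_pair_eq: "dual_pair k (P, Om) = (S, Pi_vec)"
  unfolding dual_pair_def using THE_is_Pi_vec by simp

lemma dual_pair_dual: "dual_pair k (S, Pi_vec) = (P, Om)"
proof -
  interpret D: dirac k S Pi_vec using linear_dirac_dual by unfold_locales
  have "Om = D.Pi_vec" using D.is_Pi_vec_iff[THEN iffD1, OF is_Pi_vec_dual] .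
  then show ?thesis using D.dual_pair_eq S_vec_dual by simp
qed

lemma dirac_to_pair_eq_covector_pair:
  "dirac_to_pair (Suc k) (P, Om) = covector_pair (Suc k) (dual_pair k (P, Om))"
  unfolding dirac_to_pair_eq dual_pair_eq covector_pair_def by simp

end

lemma bij_betw_dual_pair:
  "bij_betw (dual_pair k) {(P, Om :: (nat \<Rightarrow> 'v::euclidean_space) \<Rightarrow> real). linear_dirac (Suc k) P Om}
    {(P, Om). linear_dirac (Suc k) P Om}"
proof (rule bij_betw_byWitness[where f' = "dual_pair k"])
  let ?D = "{(P, Om :: (nat \<Rightarrow> 'v) \<Rightarrow> real). linear_dirac (Suc k) P Om}"
  have dual: "dual_pair k x \<in> ?D \<and> dual_pair k (dual_pair k x) = x" if xD: "x \<in> ?D" for x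
  proof -
    obtain P Om where x: "x = (P, Om)" and LD: "linear_dirac (Suc k) P Om" using xD by (cases x) auto
    interpret dirac k P Om using LD by unfold_locales
    show ?thesis unfolding x dual_pair_eq dual_pair_dual using linear_dirac_dual by simp
  qed
  then show "\<forall>x\<in>?D. dual_pair k (dual_pair k x) = x" "\<forall>x\<in>?D. dual_pair k (dual_pair k x) = x"
    "dual_pair k ` ?D \<subseteq> ?D" "dual_pair k ` ?D \<subseteq> ?D"
    by (meson image_subsetI)+
qed

lemma bij_betw_covector_pair:
  "bij_betw (covector_pair (Suc k)) {(P, Om :: (nat \<Rightarrow> 'v::euclidean_space) \<Rightarrow> real). linear_dirac (Suc k) P Om}
    {(S, Pv). condH' (Suc k) S Pv}"
proof -
  let ?D = "{(P, Om :: (nat \<Rightarrow> 'v) \<Rightarrow> real). linear_dirac (Suc k) P Om}"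
  let ?C = "{(S, Pv). condH' (Suc k) S Pv}"
  define pull :: "('v \<Rightarrow> real) set \<times> ((nat \<Rightarrow> ('v \<Rightarrow> real)) \<Rightarrow> real) \<Rightarrow> 'v set \<times> ((nat \<Rightarrow> 'v) \<Rightarrow> real)"
    where "pull = (\<lambda>(S, Pv). (inner -` S, pull_form Pv))"
  have D: "pull (covector_pair (Suc k) x) = x \<and> covector_pair (Suc k) x \<in> ?C" if xD: "x \<in> ?D" for x
  proof -
    obtain P Om where x: "x = (P, Om)" and LD: "linear_dirac (Suc k) P Om" using xD by (cases x) auto
    show ?thesis unfolding x using condH'_push_form[OF LD]
      by (simp add: pull_def covector_pair_def inner_vimage_image pull_push_form)
  qed
  have C: "covector_pair (Suc k) (pull y) = y \<and> pull y \<in> ?D" if yC: "y \<in> ?C" for y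
  proof -
    obtain S Pv where y: "y = (S, Pv)" and H: "condH' (Suc k) S Pv" using yC by (cases y) auto
    have S: "dual_subspace S" using H unfolding condH'_def by simp
    have Pv: "Pv \<in> Forms cadd csc S (Suc k)" using H unfolding condH'_def by simp
    have S_eq: "S = inner ` (inner -` S)" using dual_subspace_eq_image_vimage[OF S] .
    have "covector_pair (Suc k) (inner -` S, pull_form Pv) = (S, Pv)"
      using push_pull_form[of Pv "inner -` S"] Pv S_eq[symmetric] by (simp add: covector_pair_def)
    moreover have "linear_dirac (Suc k) (inner -` S) (pull_form Pv)"
      using linear_dirac_pull_form[OF H S_eq subspace_vimage_inner[OF S]] .
    ultimately show ?thesis unfolding y pull_def by simp
  qed
  show ?thesis
    by (rule bij_betw_byWitness[where f' = pull]) (use D C in \<open>meson image_subsetI\<close>)+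
qed

lemma bij_betw_dirac_to_pair:
  "bij_betw (dirac_to_pair (Suc k))
    {(P, Om :: (nat \<Rightarrow> 'v::euclidean_space) \<Rightarrow> real). linear_dirac (Suc k) P Om}
    {(S, Pv). condH' (Suc k) S Pv}"
proof -
  let ?D = "{(P, Om :: (nat \<Rightarrow> 'v) \<Rightarrow> real). linear_dirac (Suc k) P Om}"
  let ?C = "{(S, Pv). condH' (Suc k) S Pv}"
  have "dirac_to_pair (Suc k) x = (covector_pair (Suc k) \<circ> dual_pair k) x" if xD: "x \<in> ?D" for x
  proof -
    obtain P Om where x: "x = (P, Om)" and LD: "linear_dirac (Suc k) P Om" using xD by (cases x) auto
    interpret dirac k P Om using LD by unfold_locales
    show ?thesis unfolding x by (simp add: dirac_to_pair_eq_covector_pair)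
  qed
  then have "bij_betw (dirac_to_pair (Suc k)) ?D ?C = bij_betw (covector_pair (Suc k) \<circ> dual_pair k) ?D ?C"
    by (rule bij_betw_cong)
  then show ?thesis using bij_betw_trans[OF bij_betw_dual_pair bij_betw_covector_pair] by simp
qed

theorem proposition4p5:
  fixes p :: nat
  assumes "2 \<le> p" and "p \<le> DIM('v::euclidean_space)"
  shows "(\<forall>P (Om :: (nat \<Rightarrow> 'v) \<Rightarrow> real). linear_dirac p P Om \<longrightarrow> (\<exists>!Pv. is_Pi_of p P Om Pv))
    \<and> bij_betw (dirac_to_pair p)
        {(P, Om :: (nat \<Rightarrow> 'v) \<Rightarrow> real). linear_dirac p P Om}
        {(S, Pv). condH' p S Pv}"
proof -
  obtain k where p: "p = Suc k" using assms(1) by (cases p) auto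
  have "\<forall>P (Om :: (nat \<Rightarrow> 'v) \<Rightarrow> real). linear_dirac p P Om \<longrightarrow> (\<exists>!Pv. is_Pi_of p P Om Pv)"
  proof (intro allI impI)
    fix P and Om :: "(nat \<Rightarrow> 'v) \<Rightarrow> real"
    assume LD: "linear_dirac p P Om"
    interpret dirac k P Om using LD unfolding p by unfold_locales
    show "\<exists>!Pv. is_Pi_of p P Om Pv" unfolding p by (rule ex1_is_Pi_of)
  qed
  moreover have "bij_betw (dirac_to_pair p) {(P, Om :: (nat \<Rightarrow> 'v) \<Rightarrow> real). linear_dirac p P Om}
      {(S, Pv). condH' p S Pv}"
    unfolding p by (rule bij_betw_dirac_to_pair)
  ultimately show ?thesis by (rule conjI)
qed

end
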